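(* For every integer $N\ge 3$, every non-zero eigenvalue $\mu$ of the adjacency matrix of the discrete torus $T^2_N$ has multiplicity $m_{T^2_N}(\mu)\le 24$. Moreover this bound is optimal: there exist an integer $N\ge 3$ and a non-zero eigenvalue $\mu$ of $T^2_N$ with $m_{T^2_N}(\mu)=24$.
   Context: For an integer $N\ge 3$, $T^2_N$ is the Cayley graph of the group $(\mathbb{Z}/N\mathbb{Z})^2$ with generating set $\{(0,1),(0,-1),(1,0),(-1,0)\}$. The eigenvalues of its adjacency matrix are $\mu(k_1,k_2)=2\cos\frac{2k_1\pi}{N}+2\cos\frac{2k_2\pi}{N}$, where $(k_1,k_2)$ runs over $(\mathbb{Z}/N\mathbb{Z})^2$, and the multiplicity $m_{T^2_N}(\mu)$ of $\mu$ is the number of pairs $(k_1,k_2)\in(\mathbb{Z}/N\mathbb{Z})^2$ with $\mu(k_1,k_2)=\mu$. *)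

theory Defs
  imports "Jordan_Normal_Form.Char_Poly" "HOL-Algebra.Elementary_Groups"
    "Graph_Theory.Pair_Digraph" Complex_Main
begin

text \<open>The Cayley graph of a group with respect to a set \<open>S\<close>, as a digraph; it is symmetric when
  \<open>S\<close> is closed under inverses.\<close>

definition cayley_graph :: "('a, 'b) monoid_scheme \<Rightarrow> 'a set \<Rightarrow> 'a pair_pre_digraph" where
  "cayley_graph G S =
     \<lparr> pverts = carrier G,
       parcs = {(x, x \<otimes>\<^bsub>G\<^esub> s) | x s. x \<in> carrier G \<and> s \<in> S} \<rparr>"

text \<open>The adjacency matrix of a digraph without parallel arcs, with rows and columns ordered by an
  enumeration \<open>vs\<close> of its vertices; the spectrum does not depend on the enumeration.\<close>

definition adjacency_mat :: "'a pair_pre_digraph \<Rightarrow> 'a list \<Rightarrow> real mat" where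
  "adjacency_mat G vs =
     mat (length vs) (length vs) (\<lambda>(i, j). if (vs ! i, vs ! j) \<in> parcs G then 1 else 0)"

definition torus_group :: "nat \<Rightarrow> (int \<times> int) monoid" where
  "torus_group N = integer_mod_group N \<times>\<times> integer_mod_group N"

text \<open>Residue classes are represented in \<open>{0..<N}\<close>, so \<open>-1\<close> has to be reduced modulo \<open>N\<close>.\<close>

definition discrete_torus :: "nat \<Rightarrow> (int \<times> int) pair_pre_digraph" where
  "discrete_torus N =
     cayley_graph (torus_group N) {(0, 1), (0, (- 1) mod int N), (1, 0), ((- 1) mod int N, 0)}"

definition torus_vertices :: "nat \<Rightarrow> (int \<times> int) list" where
  "torus_vertices N = List.product [0..int N - 1] [0..int N - 1]"

lemma distinct_torus_vertices: "distinct (torus_vertices N)"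
  by (simp add: torus_vertices_def distinct_product)

lemma set_torus_vertices: "N > 0 \<Longrightarrow> set (torus_vertices N) = pverts (discrete_torus N)"
  by (auto simp: torus_vertices_def discrete_torus_def cayley_graph_def torus_group_def
      carrier_integer_mod_group)

definition torus_adjacency_mat :: "nat \<Rightarrow> real mat" where
  "torus_adjacency_mat N = adjacency_mat (discrete_torus N) (torus_vertices N)"

text \<open>The eigenvalue belonging to the character of \<open>(\<int>/N\<int>)\<^sup>2\<close> with index \<open>(k\<^sub>1, k\<^sub>2)\<close>.\<close>

definition torus_eigenvalue :: "nat \<Rightarrow> int \<times> int \<Rightarrow> real" where
  "torus_eigenvalue N = (\<lambda>(k1, k2).
     2 * cos (2 * real_of_int k1 * pi / real N) + 2 * cos (2 * real_of_int k2 * pi / real N))"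

text \<open>As the characters form a basis of eigenvectors, the multiplicity of an eigenvalue is the number
  of indices that give this value.\<close>

definition torus_multiplicity :: "nat \<Rightarrow> real \<Rightarrow> nat" where
  "torus_multiplicity N \<mu> = card {k \<in> carrier (torus_group N). torus_eigenvalue N k = \<mu>}"

end

theory Submission
  imports Defs "HOL-Number_Theory.Cong"
begin

text \<open>An index $(k_1, k_2)$ corresponds to a pair $(x, y)$ of $N$-th roots of unity with
  $2 \mathrm{Re}\, x + 2 \mathrm{Re}\, y = \mu$, and each unordered pair of real parts comes from at most 8
  pairs $(x, y)$. So it suffices that for $\mu \neq 0$ there are no four solutions with pairwise different
  unordered pairs of real parts.

  Let $N = q m$. Galois conjugation shows that the vectors of class sums (the sums of those
  $z \in \{x, \bar x, y, \bar y\}$ with $z^m = \kappa$, where $\kappa^q = 1$) of two solutions agree if every prime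
  factor of $q$ divides $m$, and are essentially translates of each other by a constant if $q$ is a prime
  not dividing $m$. A class sum $b$ at a non-real $\kappa$ is a single root of unity or a sum of two of
  them. As such a representation is unique, at most two solutions share it, and if there are two then one
  of them has the real parts $\{\mu/2, 0\}$. For a prime $q \ge 5$ not dividing $m$ the constant is $0$ or
  $\pm 1$, so at most two different vectors occur and together they account for at most three solutions.
  Taking $q = p$ with $p^2 \mid N$ odd, $q = 4$ with $8 \mid N$, or $q = p \ge 7$, one descends to
  $N \mid 60$, and $q = 5$ leaves $N = 12$, where all values are explicit. Equality holds for $N = 60$ and
  $\cos\frac{\pi}{5} = \cos\frac{\pi}{3} + \cos\frac{2\pi}{5} =
  \cos\frac{2\pi}{15} + \cos\frac{8\pi}{15}$.\<close>

hide_const (open) module.smult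

section \<open>Conjugates of roots of unity\<close>

text \<open>Gauss's lemma: passing to primitive parts turns the constant \<open>c\<close> into a
  sign. This is what makes divisibility over the integers, and not just over the rationals,
  available for \<open>int_minimal_poly\<close>.\<close>

lemma primitive_dvd_smult_cancel:
  fixes p q :: "int poly"
  assumes "content p = 1" "c \<noteq> 0" "p dvd smult c q"
  shows "p dvd q"
proof -
  have "primitive_part p dvd primitive_part (smult c q)"
    using assms(3) by (rule primitive_part_dvd_primitive_partI)
  hence "p dvd smult (unit_factor c) (primitive_part q)"
    using assms(1) by (simp add: primitive_part_prim primitive_part_smult)
  moreover have "is_unit (unit_factor c)"
    using assms(2) by simp
  ultimately have "p dvd primitive_part q"
    by (simp add: dvd_smult_cancel sgn_if split: if_splits)
  thus ?thesis
    by (metis content_times_primitive_part dvd_smult)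
qed

text \<open>Take an integer polynomial of least degree among the non-zero ones vanishing at
  \<open>z\<close> and divide it by its content. Pseudo-division by it leaves a remainder that
  vanishes at \<open>z\<close>, hence is 0, and the power of the leading coefficient that it
  introduces is cancelled by Gauss's lemma.\<close>

lemma int_minimal_poly:
  fixes z :: complex
  assumes "P \<noteq> 0" "poly (of_int_poly P) z = 0"
  obtains f :: "int poly" where "f \<noteq> 0" "content f = 1" "poly (of_int_poly f) z = 0"
    "\<And>Q. poly (of_int_poly Q) z = 0 \<Longrightarrow> f dvd Q"
    "\<And>Q. poly (of_int_poly Q) z = 0 \<Longrightarrow> degree Q < degree f \<Longrightarrow> Q = 0"
proof -
  define V where "V = (\<lambda>Q::int poly. Q \<noteq> 0 \<and> poly (of_int_poly Q) z = 0)"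
  have "V P" using assms by (simp add: V_def)
  then obtain g where g: "V g" and gmin: "\<And>Q. V Q \<Longrightarrow> degree g \<le> degree Q"
    using ex_has_least_nat[of V P degree] by blast
  define f where "f = primitive_part g"
  have f0: "f \<noteq> 0" using g by (simp add: f_def V_def)
  have cf: "content f = 1" using g by (simp add: f_def V_def)
  have gf: "g = smult (content g) f" by (simp add: f_def)
  have cg: "content g \<noteq> 0" using g by (simp add: V_def)
  have "poly (of_int_poly g) z = of_int (content g) * poly (of_int_poly f) z"
    by (subst gf) (simp add: of_int_hom.map_poly_hom_smult)
  moreover have "poly (of_int_poly g) z = 0" using g by (simp add: V_def)
  ultimately have fz: "poly (of_int_poly f) z = 0" using cg by (metis mult_eq_0_iff of_int_eq_0_iff)
  have small: "Q = 0" if "poly (of_int_poly Q) z = 0" "degree Q < degree f" for Q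
    using gmin[of Q] that by (auto simp: V_def f_def)
  have dvd: "f dvd Q" if Q: "poly (of_int_poly Q) z = 0" for Q
  proof -
    define s where "s = fst (pseudo_divmod Q f)"
    define r where "r = snd (pseudo_divmod Q f)"
    define c where "c = lead_coeff f ^ (Suc (degree Q) - degree f)"
    have eq: "smult c Q = f * s + r" and deg: "r = 0 \<or> degree r < degree f"
      using pseudo_divmod[OF f0, of Q s r] by (simp_all add: s_def r_def c_def)
    have "poly (of_int_poly (smult c Q)) z = 0"
      using Q by (simp add: of_int_hom.map_poly_hom_smult)
    hence "poly (of_int_poly r) z = 0"
      unfolding eq using fz by (simp add: of_int_poly_hom.hom_add of_int_poly_hom.hom_mult)
    hence "r = 0" using deg small by blast
    hence "f dvd smult c Q" using eq by simp
    moreover have "c \<noteq> 0" using f0 by (simp add: c_def)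
    ultimately show ?thesis using primitive_dvd_smult_cancel cf by blast
  qed
  show ?thesis by (rule that[OF f0 cf fz dvd small])
qed

section \<open>Frobenius congruences modulo a prime\<close>

lemma prime_dvd_add_power:
  fixes a b :: "'a::comm_ring_1"
  assumes "prime p"
  shows "of_nat p dvd (a + b) ^ p - a ^ p - b ^ p"
proof -
  have p: "p > 0" using assms prime_gt_0_nat by blast
  have "(a + b) ^ p = (\<Sum>k\<le>p. of_nat (p choose k) * a ^ k * b ^ (p - k))"
    by (rule binomial_ring)
  also have "{..p} = insert 0 (insert p {0<..<p})"
    by auto
  also have "(\<Sum>k\<in>insert 0 (insert p {0<..<p}). of_nat (p choose k) * a ^ k * b ^ (p - k)) =
      b ^ p + (a ^ p + (\<Sum>k\<in>{0<..<p}. of_nat (p choose k) * a ^ k * b ^ (p - k)))"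
    using p by (simp add: sum.insert)
  finally have "(a + b) ^ p - a ^ p - b ^ p = (\<Sum>k\<in>{0<..<p}. of_nat (p choose k) * a ^ k * b ^ (p - k))"
    by (simp add: algebra_simps)
  moreover have "of_nat p dvd (of_nat (p choose k) :: 'a)" if "k \<in> {0<..<p}" for k
    using dvd_choose_prime[of k p] that assms by (auto simp: dvd_def)
  ultimately show ?thesis
    by (auto intro!: dvd_sum dvd_mult2)
qed

text \<open>Fermat's little theorem, by induction from the binomial congruence. For
  \<open>a = - int n\<close> the same congruence applied to \<open>a + int n = 0\<close> avoids a
  distinction by the parity of \<open>p\<close>.\<close>

lemma int_power_prime_minus_self_dvd:
  assumes "prime p"
  shows "int p dvd a ^ p - a"
proof -
  have nat: "int p dvd int n ^ p - int n" for n
  proof (induction n)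
    case 0
    show ?case using assms prime_gt_0_nat[of p] by (simp add: power_0_left)
  next
    case (Suc n)
    have "int p dvd (int n + 1) ^ p - int n ^ p - 1 ^ p"
      using prime_dvd_add_power[OF assms, of "int n" 1] by simp
    from dvd_add[OF this Suc] show ?case by (simp add: algebra_simps)
  qed
  show ?thesis
  proof (cases "a \<ge> 0")
    case True
    thus ?thesis using nat[of "nat a"] by simp
  next
    case False
    define n where "n = nat (- a)"
    have a: "a = - int n" using False by (simp add: n_def)
    have "int p dvd (a + int n) ^ p - a ^ p - int n ^ p"
      using prime_dvd_add_power[OF assms, of a "int n"] by simp
    hence "int p dvd - (a ^ p) - int n ^ p"
      using a assms prime_gt_0_nat[of p] by (simp add: power_0_left)
    from dvd_add[OF this nat[of n]] have "int p dvd - (a ^ p - a)" using a by simp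
    thus ?thesis by (simp only: dvd_minus_iff)
  qed
qed

text \<open>Induction along the Horner form \<open>a + X f\<close>: the binomial congruence splits
  the power, and Fermat's little theorem handles the constant coefficient.\<close>

lemma prime_dvd_pcompose_monom_minus_power:
  fixes f :: "int poly"
  assumes "prime p"
  shows "of_nat p dvd pcompose f (monom 1 p) - f ^ p"
proof (induction f)
  case 0
  show ?case using assms prime_gt_0_nat[of p] by (simp add: power_0_left)
next
  case (pCons a f)
  have 1: "of_nat p dvd [:a:] - [:a:] ^ p"
  proof -
    from int_power_prime_minus_self_dvd[OF assms, of a] obtain c where "a ^ p - a = int p * c" ..
    hence "[:a:] - [:a:] ^ p = of_nat p * [:- c:]"
      by (simp add: of_nat_poly poly_const_pow algebra_simps)
    thus ?thesis ..
  qed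
  have X: "monom 1 p = ([:0, 1:] :: int poly) ^ p"
    by (simp add: monom_altdef)
  have dec: "pCons a f = [:a:] + [:0, 1:] * f" by simp
  have "of_nat p dvd ([:a:] + [:0, 1:] * f) ^ p - [:a:] ^ p - ([:0, 1:] * f) ^ p"
    by (rule prime_dvd_add_power[OF assms])
  hence 2: "of_nat p dvd (pCons a f) ^ p - [:a:] ^ p - monom 1 p * f ^ p"
    unfolding dec X by (simp only: power_mult_distrib)
  have 3: "of_nat p dvd monom 1 p * (pcompose f (monom 1 p) - f ^ p)"
    using pCons.IH by (rule dvd_mult)
  have eq: "pcompose (pCons a f) (monom 1 p) - pCons a f ^ p =
      ([:a:] - [:a:] ^ p) + monom 1 p * (pcompose f (monom 1 p) - f ^ p)
      - ((pCons a f) ^ p - [:a:] ^ p - monom 1 p * f ^ p)"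
    unfolding pcompose_pCons by (simp add: algebra_simps)
  show ?case
    unfolding eq by (rule dvd_diff[OF dvd_add[OF 1 3] 2])
qed

text \<open>If $f(\zeta^q) \neq 0$, differentiating $X^N - 1 = f h$ at $\xi = \zeta^q$ gives
  $N \xi^{N-1} = f(\xi) h'(\xi)$, which lies in $q \mathbb{Z}[\zeta]$ because $f(X^q) \equiv f(X)^q$ mod $q$.\<close>

lemma root_of_unity_prime_conjugate:
  fixes z :: complex and P :: "int poly"
  assumes N: "N > 0" and z: "z ^ N = 1" and q: "prime q" "\<not> q dvd N"
    and P: "poly (of_int_poly P) z = 0"
  shows "poly (of_int_poly P) (z ^ q) = 0"
proof -
  define U :: "int poly" where "U = monom 1 N - 1"
  define ev where "ev = (\<lambda>(Q::int poly) (w::complex). poly (of_int_poly Q) w)"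
  have ev_simps [simp]: "ev (A + B) w = ev A w + ev B w" "ev (A - B) w = ev A w - ev B w"
    "ev (A * B) w = ev A w * ev B w" "ev (A ^ k) w = ev A w ^ k" "ev (monom 1 k) w = w ^ k"
    "ev 1 w = 1" "ev (of_nat k) w = of_nat k"
    "ev (smult c A) w = of_int c * ev A w" for A B w k c
    by (simp_all add: ev_def of_int_poly_hom.hom_add of_int_poly_hom.hom_minus
        of_int_poly_hom.hom_mult of_int_poly_hom.hom_power of_int_hom.map_poly_hom_smult
        of_int_hom.map_poly_hom_monom poly_monom of_int_poly_hom.hom_of_nat)
  have ev_comp: "ev (pcompose A B) w = ev A (ev B w)" for A B w
    by (simp add: ev_def of_int_hom.map_poly_pcompose poly_pcompose)
  have "U \<noteq> 0"
  proof
    assume "U = 0"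
    hence "coeff U N = 0" by simp
    thus False using N by (simp add: U_def)
  qed
  moreover have "ev U z = 0" using z by (simp add: U_def)
  ultimately obtain f where f: "f \<noteq> 0" "content f = 1" "ev f z = 0"
    and dvd: "\<And>Q. ev Q z = 0 \<Longrightarrow> f dvd Q" and small: "\<And>Q. ev Q z = 0 \<Longrightarrow> degree Q < degree f \<Longrightarrow> Q = 0"
    unfolding ev_def using int_minimal_poly by metis
  have "f dvd U" by (rule dvd) (use z in \<open>simp add: U_def\<close>)
  then obtain h where h: "U = f * h" ..
  have degU: "lead_coeff U = 1"
  proof -
    have "degree U = N" unfolding U_def
      by (rule antisym[OF degree_diff_le le_degree]) (use N in \<open>simp_all add: degree_monom_eq\<close>)
    thus ?thesis using N by (simp add: U_def)
  qed
  \<comment> \<open>\<open>U\<close> is monic, so \<open>f\<close> has a unit as leading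
    coefficient, and pseudo-division by \<open>f\<close> scales only by a unit
    \<open>c\<close>.\<close>
  hence lc: "lead_coeff f * lead_coeff h = 1" by (simp add: h lead_coeff_mult)
  define \<xi> where "\<xi> = z ^ q"
  have \<xi>N: "\<xi> ^ N = 1" using z by (simp add: \<xi>_def power_mult[symmetric] mult.commute[of q] power_mult)
  have "ev f \<xi> = 0"
  proof (rule ccontr)
    assume nz: "ev f \<xi> \<noteq> 0"
    have "ev U \<xi> = 0" using \<xi>N by (simp add: U_def)
    hence h0: "ev h \<xi> = 0" using nz by (simp add: h)
    have "pderiv U = smult (int N) (monom 1 (N - 1))"
      by (simp add: U_def pderiv_diff pderiv_monom smult_monom)
    hence "ev (pderiv U) \<xi> = of_nat N * \<xi> ^ (N - 1)" by simp
    moreover have "ev (pderiv U) \<xi> = ev f \<xi> * ev (pderiv h) \<xi>"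
      using h0 by (simp add: h pderiv_mult)
    ultimately have d: "of_nat N * \<xi> ^ (N - 1) = ev f \<xi> * ev (pderiv h) \<xi>" by simp
    from prime_dvd_pcompose_monom_minus_power[OF q(1), of f] obtain g
      where "pcompose f (monom 1 q) - f ^ q = of_nat q * g" ..
    hence "ev (pcompose f (monom 1 q) - f ^ q) z = ev (of_nat q * g) z" by simp
    hence "ev f \<xi> = of_nat q * ev g z"
      using f(3) q(1) prime_gt_0_nat[of q] by (simp add: ev_comp \<xi>_def power_0_left)
    moreover have "\<xi> ^ (N - 1) * \<xi> = 1" using \<xi>N N by (metis Suc_diff_1 power_Suc2)
    ultimately have N_eq: "of_nat N = of_nat q * (ev g z * ev (pderiv h) \<xi> * \<xi>)"
      using d by (metis mult.assoc mult.right_neutral)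
    \<comment> \<open>\<open>R\<close> exhibits the quotient of \<open>N\<close> by \<open>q\<close>
      as the value at \<open>z\<close> of an integer polynomial.\<close>
    define R where "R = g * pcompose (pderiv h) (monom 1 q) * monom 1 q"
    have R: "ev R z = ev g z * ev (pderiv h) \<xi> * \<xi>" by (simp add: R_def ev_comp \<xi>_def)
    define c where "c = lead_coeff f ^ (Suc (degree R) - degree f)"
    define r where "r = snd (pseudo_divmod R f)"
    have c: "c dvd 1" "c \<noteq> 0"
      using lc unfolding c_def by (metis dvd_triv_left dvd_power_same power_one)
        (use f in simp)
    have "smult c R = f * fst (pseudo_divmod R f) + r" and deg: "r = 0 \<or> degree r < degree f"
      using pseudo_divmod[OF f(1), of R "fst (pseudo_divmod R f)" r] by (simp_all add: r_def c_def)
    hence "ev (smult c R) z = ev (f * fst (pseudo_divmod R f) + r) z" by simp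
    hence rz: "ev r z = of_int c * ev R z" using f(3) by simp
    \<comment> \<open>\<open>T\<close> vanishes at \<open>z\<close> and has smaller degree than the
      minimal polynomial, so it is 0; its constant coefficient then shows that \<open>q\<close>
      divides \<open>c * N\<close>.\<close>
    define T where "T = smult (int q) r - of_nat N * smult c 1"
    have "ev T z = 0" by (simp only: T_def ev_simps rz N_eq R) simp
    moreover have degf: "degree f > 0"
    proof (rule ccontr)
      assume "\<not> degree f > 0"
      then obtain a where "f = [:a:]" by (metis degree_eq_zeroE neq0_conv)
      thus False using f by (simp add: ev_def)
    qed
    have "degree r < degree f" using deg degf by auto
    hence "degree T < degree f" unfolding T_def
      using degf by (intro degree_diff_less) (auto simp: of_nat_poly intro: le_less_trans[OF degree_smult_le])
    ultimately have "T = 0" using small by blast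
    hence "coeff T 0 = 0" by simp
    hence "int q * coeff r 0 = c * int N" by (simp add: T_def of_nat_poly)
    hence "int q dvd c * int N" by (metis dvd_triv_left)
    hence "int q dvd int N" using c by (metis dvd_mult_unit_iff')
    thus False using q(2) by simp
  qed
  moreover obtain s where "P = f * s" using dvd[of P] P by (auto simp: ev_def)
  ultimately have "ev P \<xi> = 0" by simp
  thus ?thesis by (simp add: ev_def \<xi>_def)
qed

text \<open>Induction over the prime factors of \<open>k\<close>, none of which divides
  \<open>N\<close>; each step raises the current root to one more prime power exponent.\<close>

lemma root_of_unity_conjugate:
  fixes z :: complex and P :: "int poly"
  assumes "N > 0" "z ^ N = 1" "coprime k N" "k > 0" "poly (of_int_poly P) z = 0"
  shows "poly (of_int_poly P) (z ^ k) = 0"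
  using assms(3,4)
proof (induction k rule: prime_divisors_induct)
  case (factor p k)
  have "\<not> p dvd N"
    using factor.hyps factor.prems coprime_common_divisor by (metis dvd_triv_left not_prime_unit)
  moreover have "poly (of_int_poly P) (z ^ k) = 0"
    using factor by simp
  moreover have "(z ^ k) ^ N = 1"
    using assms(2) by (metis mult.commute power_mult power_one)
  ultimately show ?case
    using root_of_unity_prime_conjugate[OF assms(1), of "z ^ k" p P] factor.hyps
    by (simp add: power_mult[symmetric] mult.commute)
next
  case (unit k)
  thus ?case using assms(5) by simp
qed simp

text \<open>All \<open>x j\<close> are powers of the single root
  \<open>z = cis (2 * pi / N)\<close>, so the relation says that an integer polynomial vanishes at
  \<open>z\<close>.\<close>

lemma root_of_unity_relation_conjugate:
  fixes x :: "'a \<Rightarrow> complex" and c :: "'a \<Rightarrow> int"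
  assumes "N > 0" "finite J" "\<And>j. j \<in> J \<Longrightarrow> x j ^ N = 1" "coprime k N" "k > 0"
    and "(\<Sum>j\<in>J. of_int (c j) * x j) = 0"
  shows "(\<Sum>j\<in>J. of_int (c j) * x j ^ k) = 0"
proof -
  define z where "z = cis (2 * pi / real N)"
  have z: "z ^ N = 1" using assms(1) by (simp add: z_def DeMoivre)
  have "\<exists>e. x j = z ^ e" if "j \<in> J" for j
  proof -
    have "x j \<in> (\<lambda>k. cis (2 * pi * real k / real N)) ` {..<N}"
      using bij_betw_roots_unity[OF assms(1)] assms(3)[OF that] unfolding bij_betw_def by simp
    then obtain e where "x j = cis (2 * pi * real e / real N)" by blast
    hence "x j = z ^ e" by (simp add: z_def DeMoivre mult_ac)
    thus ?thesis ..
  qed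
  then obtain e where e: "\<And>j. j \<in> J \<Longrightarrow> x j = z ^ e j" by metis
  define P where "P = (\<Sum>j\<in>J. monom (c j) (e j))"
  have P: "poly (of_int_poly P) w = (\<Sum>j\<in>J. of_int (c j) * w ^ e j)" for w :: complex
    by (simp add: P_def of_int_poly_hom.hom_sum of_int_hom.map_poly_hom_monom poly_sum poly_monom)
  have "poly (of_int_poly P) z = 0" using assms(6) e by (simp add: P)
  hence "poly (of_int_poly P) (z ^ k) = 0"
    by (rule root_of_unity_conjugate[OF assms(1) z assms(4,5)])
  thus ?thesis using e by (simp add: P flip: power_mult) (simp add: mult.commute)
qed

section \<open>Class sums\<close>

lemma sum_powers_root_of_unity:
  fixes w :: "'a::field"
  assumes "w ^ q = 1"
  shows "(\<Sum>t<q. w ^ t) = (if w = 1 then of_nat q else 0)"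
  using assms by (simp add: geometric_sum)

text \<open>The automorphisms $\zeta \mapsto \zeta^{1 + tm}$ multiply each $x$ by the $t$-th power of its
  class $x^m$; the class sums are recovered from the conjugate relations by Fourier inversion over
  the $q$-th roots of unity.\<close>

lemma class_sums_proportional:
  fixes x :: "'a \<Rightarrow> complex" and c :: "'a \<Rightarrow> int"
  assumes N: "N = q * m" "N > 0" and J: "finite J" and x: "\<And>j. j \<in> J \<Longrightarrow> x j ^ N = 1"
    and cop: "\<And>t. t < q \<Longrightarrow> t \<noteq> t0 \<Longrightarrow> coprime (1 + t * m) N" and t0: "t0 < q"
    and \<kappa>: "\<kappa> ^ q = 1" and rel: "(\<Sum>j\<in>J. of_int (c j) * x j) = 0"
  shows "\<kappa> ^ t0 * (\<Sum>j\<in>J. if x j ^ m = \<kappa> then of_int (c j) * x j else 0) =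
    (\<Sum>j\<in>J. if x j ^ m = 1 then of_int (c j) * x j else 0)"
proof -
  define b where "b = (\<lambda>\<kappa>. \<Sum>j\<in>J. if x j ^ m = \<kappa> then of_int (c j) * x j else 0)"
  \<comment> \<open>\<open>F t\<close> is the relation conjugated by the exponent
    \<open>1 + t * m\<close>. Coprimality may fail at \<open>t0\<close> only, so \<open>F t0\<close>
    is the only value that can be non-zero.\<close>
  define F where "F = (\<lambda>t. \<Sum>j\<in>J. of_int (c j) * x j * (x j ^ m) ^ t)"
  have F0: "F t = 0" if "t < q" "t \<noteq> t0" for t
  proof -
    have "(\<Sum>j\<in>J. of_int (c j) * x j ^ (1 + t * m)) = 0"
      by (rule root_of_unity_relation_conjugate[OF N(2) J x cop[OF that] _ rel]) auto
    thus ?thesis by (simp add: F_def power_add mult.assoc mult.commute[of t] power_mult)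
  qed
  have key: "of_nat q * (\<kappa> ^ t0 * b \<kappa>) = F t0" if \<kappa>: "\<kappa> ^ q = 1" for \<kappa>
  proof -
    have q: "q > 0" using N by (cases q) auto
    hence \<kappa>0: "\<kappa> \<noteq> 0" using \<kappa> by (auto simp: power_0_left)
    \<comment> \<open>The sum is evaluated twice: only \<open>t0\<close> survives, and after
      exchanging the sums the geometric series selects the class of \<kappa>.\<close>
    have "(\<Sum>t<q. (1 / \<kappa>) ^ t * F t) = (\<Sum>t\<in>{t0}. (1 / \<kappa>) ^ t * F t)"
      by (rule sum.mono_neutral_right) (use t0 F0 in auto)
    hence "(1 / \<kappa>) ^ t0 * F t0 = (\<Sum>t<q. (1 / \<kappa>) ^ t * F t)" by simp
    also have "\<dots> = (\<Sum>j\<in>J. of_int (c j) * x j * (\<Sum>t<q. (x j ^ m / \<kappa>) ^ t))"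
      unfolding F_def sum_distrib_left
      by (subst sum.swap) (simp add: power_divide field_simps)
    also have "\<dots> = (\<Sum>j\<in>J. of_nat q * (if x j ^ m = \<kappa> then of_int (c j) * x j else 0))"
    proof (rule sum.cong[OF refl])
      fix j assume j: "j \<in> J"
      have "(x j ^ m / \<kappa>) ^ q = 1"
        using x[OF j] \<kappa> by (simp add: power_divide N mult.commute[of q] power_mult)
      thus "of_int (c j) * x j * (\<Sum>t<q. (x j ^ m / \<kappa>) ^ t) =
          of_nat q * (if x j ^ m = \<kappa> then of_int (c j) * x j else 0)"
        using \<kappa>0 by (simp add: sum_powers_root_of_unity)
    qed
    also have "\<dots> = of_nat q * b \<kappa>" by (simp add: b_def sum_distrib_left)
    finally have "(1 / \<kappa>) ^ t0 * F t0 = of_nat q * b \<kappa>" .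
    thus ?thesis using \<kappa>0 by (simp add: power_divide field_simps)
  qed
  have "q \<noteq> 0" using N by auto
  hence "\<kappa> ^ t0 * b \<kappa> = b 1" using key[OF \<kappa>] key[of 1] by (metis mult_1 mult_left_cancel of_nat_eq_0_iff power_one)
  thus ?thesis by (simp add: b_def)
qed

text \<open>A real \<open>z\<close> counts twice, so that the parts over all classes always add up
  to \<open>2 * Re z\<close>.\<close>

definition class_part :: "nat \<Rightarrow> complex \<Rightarrow> complex \<Rightarrow> complex" where
  "class_part m \<kappa> z = (if z ^ m = \<kappa> then z else 0) + (if cnj z ^ m = \<kappa> then cnj z else 0)"

definition class_sum :: "nat \<Rightarrow> complex \<Rightarrow> complex \<times> complex \<Rightarrow> complex" where
  "class_sum m \<kappa> = (\<lambda>(x, y). class_part m \<kappa> x + class_part m \<kappa> y)"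

definition sols :: "nat \<Rightarrow> real \<Rightarrow> (complex \<times> complex) set" where
  "sols N \<mu> = {(x, y). x ^ N = 1 \<and> y ^ N = 1 \<and> 2 * Re x + 2 * Re y = \<mu>}"

definition sim :: "complex \<times> complex \<Rightarrow> complex \<times> complex \<Rightarrow> bool" where
  "sim = (\<lambda>(x, y) (x', y'). Re x = Re x' \<and> Re y = Re y' \<or> Re x = Re y' \<and> Re y = Re x')"

text \<open>Two solutions give a vanishing signed sum of eight roots of unity, the two pairs and
  their conjugates, to which \<open>class_sums_proportional\<close> applies.\<close>

lemma class_sum_diff_proportional:
  assumes N: "N = q * m" "N > 0"
    and cop: "\<And>t. t < q \<Longrightarrow> t \<noteq> t0 \<Longrightarrow> coprime (1 + t * m) N" and t0: "t0 < q"
    and \<kappa>: "\<kappa> ^ q = 1" and D: "D \<in> sols N \<mu>" "D' \<in> sols N \<mu>"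
  shows "\<kappa> ^ t0 * (class_sum m \<kappa> D - class_sum m \<kappa> D') = class_sum m 1 D - class_sum m 1 D'"
proof -
  obtain x y x' y' where DD: "D = (x, y)" "D' = (x', y')" by (cases D, cases D') auto
  define X where "X = (!) [x, cnj x, y, cnj y, x', cnj x', y', cnj y']"
  define c :: "nat \<Rightarrow> int" where "c = (!) [1, 1, 1, 1, -1, -1, -1, -1]"
  have sum8: "(\<Sum>j\<in>{..<8::nat}. f j) = f 0 + f 1 + f 2 + f 3 + f 4 + f 5 + f 6 + f 7"
    for f :: "nat \<Rightarrow> complex"
    by (simp add: eval_nat_numeral)
  have X: "X 0 = x" "X 1 = cnj x" "X 2 = y" "X 3 = cnj y" "X 4 = x'" "X 5 = cnj x'" "X 6 = y'"
    "X 7 = cnj y'" and c: "c 0 = 1" "c 1 = 1" "c 2 = 1" "c 3 = 1" "c 4 = -1" "c 5 = -1" "c 6 = -1" "c 7 = -1"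
    by (simp_all add: X_def c_def)
  have roots: "x ^ N = 1" "y ^ N = 1" "x' ^ N = 1" "y' ^ N = 1"
    and eq: "2 * Re x + 2 * Re y = 2 * Re x' + 2 * Re y'"
    using D by (auto simp: DD sols_def)
  hence cnj_roots: "cnj x ^ N = 1" "cnj y ^ N = 1" "cnj x' ^ N = 1" "cnj y' ^ N = 1"
    by (metis complex_cnj_one complex_cnj_power)+
  have XN: "X j ^ N = 1" if "j \<in> {..<8}" for j
  proof -
    from that have "j \<in> {0, 1, 2, 3, 4, 5, 6, 7}" by auto
    thus ?thesis using roots cnj_roots X by auto
  qed
  have rel: "(\<Sum>j\<in>{..<8}. of_int (c j) * X j) = 0"
    unfolding sum8 X c using eq by (simp add: complex_eq_iff)
  have "\<kappa> ^ t0 * (\<Sum>j\<in>{..<8}. if X j ^ m = \<kappa> then of_int (c j) * X j else 0) =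
      (\<Sum>j\<in>{..<8}. if X j ^ m = 1 then of_int (c j) * X j else 0)"
    by (rule class_sums_proportional[OF N _ XN cop t0 \<kappa> rel]) auto
  moreover have "(\<Sum>j\<in>{..<8}. if X j ^ m = \<kappa> then of_int (c j) * X j else 0) =
      class_sum m \<kappa> D - class_sum m \<kappa> D'" for \<kappa>
  proof -
    have "(if A then - z else 0) = - (if A then z else (0::complex))" for A z by simp
    thus ?thesis unfolding sum8 X c by (simp add: DD class_sum_def class_part_def)
  qed
  ultimately show ?thesis by simp
qed

text \<open>With no bad exponent, \<open>t0\<close> is arbitrary. Comparing \<open>t0 = 0\<close>
  with \<open>t0 = 1\<close> shows that the difference is fixed by multiplication with
  \<kappa>.\<close>

lemma class_sum_eq_if_all_coprime:
  assumes N: "N = q * m" "N > 0" "q > 1" and cop: "\<And>t. coprime (1 + t * m) N"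
    and \<kappa>: "\<kappa> ^ q = 1" "\<kappa> \<noteq> 1" and D: "D \<in> sols N \<mu>" "D' \<in> sols N \<mu>"
  shows "class_sum m \<kappa> D = class_sum m \<kappa> D'"
proof -
  have "\<kappa> ^ t * (class_sum m \<kappa> D - class_sum m \<kappa> D') = class_sum m 1 D - class_sum m 1 D'" if "t < q" for t
    by (rule class_sum_diff_proportional[OF N(1,2) _ that \<kappa>(1) D]) (rule cop)
  from this[of 0] this[of 1] have "\<kappa> * (class_sum m \<kappa> D - class_sum m \<kappa> D') = class_sum m \<kappa> D - class_sum m \<kappa> D'"
    using N(3) by simp
  thus ?thesis using \<kappa>(2) by simp
qed

lemma class_sum_Pair: "class_sum m \<kappa> (x, y) = class_part m \<kappa> x + class_part m \<kappa> y"
  by (simp add: class_sum_def)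

lemma sols_Pair_iff: "(x, y) \<in> sols N \<mu> \<longleftrightarrow> x ^ N = 1 \<and> y ^ N = 1 \<and> 2 * Re x + 2 * Re y = \<mu>"
  by (simp add: sols_def)

lemma norm_eq_1_if_power_eq_1:
  fixes z :: complex
  assumes "z ^ N = 1" "N > 0"
  shows "norm z = 1"
  using assms by (metis norm_one norm_power norm_ge_zero power_eq_1_iff less_numeral_extra(3))

lemma norm_eq_1_Re_sq_neq_1:
  assumes "norm \<kappa> = 1" "\<kappa>\<^sup>2 \<noteq> 1"
  shows "cnj \<kappa> \<noteq> \<kappa>"
  using assms complex_norm_square[of \<kappa>] by (auto simp: power2_eq_square)

lemma class_part_eq_0: "Re (z ^ m) \<noteq> Re \<kappa> \<Longrightarrow> class_part m \<kappa> z = 0"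
  by (auto simp: class_part_def simp flip: complex_cnj_power)

text \<open>A non-real \<kappa> differs from its conjugate, so at most one of \<open>z\<close> and
  \<open>cnj z\<close> lies in its class.\<close>

lemma class_part_cases:
  assumes "norm \<kappa> = 1" "\<kappa>\<^sup>2 \<noteq> 1"
  shows "class_part m \<kappa> z = 0 \<and> z ^ m \<noteq> \<kappa> \<or> class_part m \<kappa> z = z \<or> class_part m \<kappa> z = cnj z"
proof (cases "z ^ m = \<kappa>")
  case True
  hence "cnj z ^ m \<noteq> \<kappa>" using norm_eq_1_Re_sq_neq_1[OF assms] by (metis complex_cnj_power)
  thus ?thesis using True by (simp add: class_part_def)
qed (simp add: class_part_def)

text \<open>On the unit circle the real part determines a number up to conjugation, so exactly one
  of \<open>z\<close> and \<open>cnj z\<close> lies in the class.\<close>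

lemma class_part_hit_cases:
  assumes "norm \<kappa> = 1" "\<kappa>\<^sup>2 \<noteq> 1" "norm z = 1" "Re (z ^ m) = Re \<kappa>"
  shows "class_part m \<kappa> z = z \<or> class_part m \<kappa> z = cnj z"
proof -
  have "norm (z ^ m) = 1" using assms(3) by (simp add: norm_power)
  hence "(Im (z ^ m))\<^sup>2 = (Im \<kappa>)\<^sup>2"
    using assms(1,4) cmod_power2[of "z ^ m"] cmod_power2[of \<kappa>] by simp
  hence "z ^ m = \<kappa> \<or> z ^ m = cnj \<kappa>"
    using assms(4) by (auto simp: power2_eq_iff complex_eq_iff)
  hence "z ^ m = \<kappa> \<or> cnj z ^ m = \<kappa>" by (metis complex_cnj_cnj complex_cnj_power)
  moreover have "\<not> (z ^ m = \<kappa> \<and> cnj z ^ m = \<kappa>)"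
    using norm_eq_1_Re_sq_neq_1[OF assms(1,2)] by (metis complex_cnj_power)
  ultimately show ?thesis by (auto simp: class_part_def)
qed

lemma Re_class_part_hit:
  assumes "norm \<kappa> = 1" "\<kappa>\<^sup>2 \<noteq> 1" "norm z = 1" "Re (z ^ m) = Re \<kappa>"
  shows "Re (class_part m \<kappa> z) = Re z" "norm (class_part m \<kappa> z) = 1"
  using class_part_hit_cases[OF assms] assms(3) by auto

lemma class_sum_1_real: "class_sum m 1 D \<in> \<real>"
proof -
  have "class_part m 1 z \<in> \<real>" for z
    by (auto simp: class_part_def complex_is_Real_iff simp flip: complex_cnj_power)
  thus ?thesis by (cases D) (simp add: class_sum_Pair)
qed

text \<open>For unit numbers \<open>u * v * cnj (u + v) = u + v\<close>, so a non-zero sum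
  determines the product, and with it the two roots of a quadratic.\<close>

lemma unit_pair_sum_unique:
  fixes u v u' v' :: complex
  assumes "norm u = 1" "norm v = 1" "norm u' = 1" "norm v' = 1"
    and "u + v = u' + v'" "u + v \<noteq> 0"
  shows "u' = u \<and> v' = v \<or> u' = v \<and> v' = u"
proof -
  have prod: "a * b * cnj (a + b) = a + b" if "norm a = 1" "norm b = 1" for a b :: complex
  proof -
    have "a * cnj a = 1" "b * cnj b = 1"
      using that complex_norm_square[of a] complex_norm_square[of b] by simp_all
    thus ?thesis by (simp add: algebra_simps)
  qed
  have "u * v * cnj (u + v) = u' * v' * cnj (u + v)"
    using prod[of u v] prod[of u' v'] assms by simp
  moreover have "cnj (u + v) \<noteq> 0" using assms(6) by (metis complex_cnj_zero_iff)
  ultimately have "u * v = u' * v'" by simp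
  hence "(u' - u) * (u' - v) = u' * (u' + v' - (u + v))" by (simp add: algebra_simps)
  hence "(u' - u) * (u' - v) = 0" using assms(5) by simp
  thus ?thesis using assms(5) by auto
qed

text \<open>A single contribution is a unit number. If both coordinates contribute, the real part is
  \<mu>/2; this is where \<mu> being non-zero enters.\<close>

lemma class_sum_neq_0:
  assumes "(x, y) \<in> sols N \<mu>" "N > 0" "\<mu> \<noteq> 0" "norm \<kappa> = 1" "\<kappa>\<^sup>2 \<noteq> 1" "x ^ m = \<kappa> \<or> y ^ m = \<kappa>"
  shows "class_sum m \<kappa> (x, y) \<noteq> 0"
proof
  assume "class_sum m \<kappa> (x, y) = 0"
  hence *: "Re (class_part m \<kappa> x) + Re (class_part m \<kappa> y) = 0"
    by (metis class_sum_Pair plus_complex.sel(1) zero_complex.sel(1))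
  have "norm x = 1" "norm y = 1"
    using assms(1,2) norm_eq_1_if_power_eq_1 by (auto simp: sols_Pair_iff)
  moreover have "Re x + Re y \<noteq> 0" using assms by (auto simp: sols_Pair_iff)
  ultimately show False
    using class_part_cases[OF assms(4,5), of m x] class_part_cases[OF assms(4,5), of m y] assms(6) *
      \<open>class_sum m \<kappa> (x, y) = 0\<close>
    by (auto simp: class_sum_Pair)
qed

lemma class_sum_one_or_two:
  assumes "(x, y) \<in> sols N \<mu>" "N > 0" "norm \<kappa> = 1" "\<kappa>\<^sup>2 \<noteq> 1" "class_sum m \<kappa> (x, y) \<noteq> 0"
  shows "Re (class_sum m \<kappa> (x, y)) \<in> {Re x, Re y} \<or>
    (\<exists>u v. norm u = 1 \<and> norm v = 1 \<and> Re u = Re x \<and> Re v = Re y \<and> class_sum m \<kappa> (x, y) = u + v)"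
proof -
  have n: "norm x = 1" "norm y = 1"
    using assms(1,2) norm_eq_1_if_power_eq_1 by (auto simp: sols_Pair_iff)
  note cs = class_part_cases[OF assms(3,4), of m x] class_part_cases[OF assms(3,4), of m y]
  show ?thesis
  proof (cases "class_part m \<kappa> x = 0 \<or> class_part m \<kappa> y = 0")
    case True
    thus ?thesis using cs assms(5) by (auto simp: class_sum_Pair)
  next
    case False
    have "norm (class_part m \<kappa> x) = 1 \<and> norm (class_part m \<kappa> y) = 1 \<and>
        Re (class_part m \<kappa> x) = Re x \<and> Re (class_part m \<kappa> y) = Re y"
      using False cs n by auto
    thus ?thesis by (metis class_sum_Pair)
  qed
qed

text \<open>The two real parts add up to \<mu>/2, so one common real part forces the other.\<close>

lemma sols_simI:
  assumes "(x, y) \<in> sols N \<mu>" "(x', y') \<in> sols N \<mu>" "r \<in> {Re x, Re y}" "r \<in> {Re x', Re y'}"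
  shows "sim (x, y) (x', y')"
  using assms by (auto simp: sols_Pair_iff sim_def)

text \<open>If both class sums are single roots, the solutions share the real part
  \<open>Re b\<close>; if both are sums of two, uniqueness applies. Either way they would be
  similar. So one of each kind occurs, and the sum of two gives \<open>Re b = \<mu> / 2\<close>; the
  other solution then has the real parts \<mu>/2 and 0.\<close>

lemma class_sum_eq_two:
  assumes N: "N > 0" and \<kappa>: "norm \<kappa> = 1" "\<kappa>\<^sup>2 \<noteq> 1"
    and D: "(x, y) \<in> sols N \<mu>" "(x', y') \<in> sols N \<mu>" "\<not> sim (x, y) (x', y')"
    and b: "class_sum m \<kappa> (x, y) = b" "class_sum m \<kappa> (x', y') = b" "b \<noteq> 0"
  shows "Re b = \<mu> / 2 \<and> (Re b \<in> {Re x, Re y} \<longleftrightarrow> Re b \<notin> {Re x', Re y'})"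
proof -
  define two where "two = (\<lambda>(x, y). \<exists>u v. norm u = 1 \<and> norm v = 1 \<and> Re u = Re x \<and> Re v = Re y \<and> b = u + v)"
  have 1: "Re b \<in> {Re x, Re y} \<or> two (x, y)" "Re b \<in> {Re x', Re y'} \<or> two (x', y')"
    using class_sum_one_or_two[OF D(1) N \<kappa>, of m] class_sum_one_or_two[OF D(2) N \<kappa>, of m] b
    by (auto simp: two_def)
  have 2: "Re b = \<mu> / 2" if "two (x, y) \<or> two (x', y')"
    using that D by (auto simp: two_def sols_Pair_iff)
  have 3: "\<not> (two (x, y) \<and> two (x', y'))"
  proof
    assume "two (x, y) \<and> two (x', y')"
    then obtain u v u' v' where *: "norm u = 1" "norm v = 1" "Re u = Re x" "Re v = Re y" "b = u + v"
      "norm u' = 1" "norm v' = 1" "Re u' = Re x'" "Re v' = Re y'" "b = u' + v'"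
      by (auto simp: two_def)
    hence "u' = u \<and> v' = v \<or> u' = v \<and> v' = u"
      using unit_pair_sum_unique[of u v u' v'] b(3) by metis
    hence "sim (x, y) (x', y')" using *(3,4,8,9) by (auto simp: sim_def)
    thus False using D(3) by contradiction
  qed
  have 4: "\<not> (Re b \<in> {Re x, Re y} \<and> Re b \<in> {Re x', Re y'})"
    using sols_simI[OF D(1,2)] D(3) by blast
  show ?thesis using 1 2 3 4 by blast
qed

text \<open>Of any two of the solutions exactly one has \<open>Re b\<close> among its real parts,
  which is impossible for three.\<close>

lemma class_sum_eq_three:
  assumes N: "N > 0" and \<kappa>: "norm \<kappa> = 1" "\<kappa>\<^sup>2 \<noteq> 1"
    and D: "D1 \<in> sols N \<mu>" "D2 \<in> sols N \<mu>" "D3 \<in> sols N \<mu>"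
      "\<not> sim D1 D2" "\<not> sim D1 D3" "\<not> sim D2 D3"
    and b: "class_sum m \<kappa> D1 = b" "class_sum m \<kappa> D2 = b" "class_sum m \<kappa> D3 = b" "b \<noteq> 0"
  shows False
proof -
  obtain x1 y1 x2 y2 x3 y3 where e: "D1 = (x1, y1)" "D2 = (x2, y2)" "D3 = (x3, y3)"
    by (metis surj_pair)
  note two = class_sum_eq_two[OF N \<kappa>]
  show False
    using two[of x1 y1 \<mu> x2 y2 m b] two[of x1 y1 \<mu> x3 y3 m b] two[of x2 y2 \<mu> x3 y3 m b] D b
    unfolding e by blast
qed

section \<open>Inequivalent solutions and their class sums\<close>

text \<open>A root of unity has square $1$ if and only if it is real.\<close>

definition has_nonreal_class :: "nat \<Rightarrow> complex \<times> complex \<Rightarrow> bool" where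
  "has_nonreal_class m = (\<lambda>(x, y). (x ^ m)\<^sup>2 \<noteq> 1 \<or> (y ^ m)\<^sup>2 \<noteq> 1)"

lemma nonreal_class_sum_neq_0:
  assumes D: "D \<in> sols N \<mu>" and N: "N = q * m" "N > 0" and "\<mu> \<noteq> 0" "has_nonreal_class m D"
  obtains \<kappa> where "\<kappa> ^ q = 1" "norm \<kappa> = 1" "\<kappa>\<^sup>2 \<noteq> 1" "class_sum m \<kappa> D \<noteq> 0"
proof -
  obtain x y where e: "D = (x, y)" by (cases D)
  obtain z where z: "z = x \<or> z = y" "(z ^ m)\<^sup>2 \<noteq> 1" using assms(5) by (auto simp: has_nonreal_class_def e)
  have zN: "z ^ N = 1" using z(1) D by (auto simp: e sols_Pair_iff)
  show ?thesis
  proof (rule that)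
    show "(z ^ m) ^ q = 1" using zN by (simp add: N mult.commute flip: power_mult)
    show n: "norm (z ^ m) = 1" using norm_eq_1_if_power_eq_1[OF zN N(2)] by (simp add: norm_power)
    show "class_sum m (z ^ m) D \<noteq> 0"
      using class_sum_neq_0[OF D[unfolded e] N(2) assms(4) n z(2)] z(1) e by blast
  qed (rule z(2))
qed

lemma no_three_if_all_coprime:
  assumes N: "N = q * m" "N > 0" "q > 1" and cop: "\<And>t. coprime (1 + t * m) N" and "\<mu> \<noteq> 0"
    and D: "D1 \<in> sols N \<mu>" "D2 \<in> sols N \<mu>" "D3 \<in> sols N \<mu>"
      "\<not> sim D1 D2" "\<not> sim D1 D3" "\<not> sim D2 D3"
    and "has_nonreal_class m D1"
  shows False
proof -
  obtain \<kappa> where \<kappa>: "\<kappa> ^ q = 1" "norm \<kappa> = 1" "\<kappa>\<^sup>2 \<noteq> 1" "class_sum m \<kappa> D1 \<noteq> 0"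
    using nonreal_class_sum_neq_0[OF D(1) N(1,2) assms(5) assms(12)] .
  have "\<kappa> \<noteq> 1" using \<kappa>(3) by auto
  note eq = class_sum_eq_if_all_coprime[OF N cop \<kappa>(1) this]
  show False
    using class_sum_eq_three[OF N(2) \<kappa>(2,3) D refl eq[OF D(2,1)] eq[OF D(3,1)] \<kappa>(4)] .
qed

text \<open>For odd \<open>q\<close>, \<open>z ^ N = (z ^ m) ^ q\<close> equals \<open>z ^ m\<close>
  as soon as \<open>z ^ m\<close> has square 1.\<close>

lemma sols_if_real_classes_odd:
  assumes "D \<in> sols N \<mu>" "N = q * m" "odd q" "\<not> has_nonreal_class m D"
  shows "D \<in> sols m \<mu>"
proof -
  obtain x y where e: "D = (x, y)" by (cases D)
  have "z ^ m = 1" if "z ^ N = 1" "(z ^ m)\<^sup>2 = 1" for z :: complex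
  proof -
    obtain k where "q = 2 * k + 1" using assms(3) oddE by blast
    hence "N = m * 2 * k + m" by (simp add: assms(2) algebra_simps)
    hence "z ^ N = ((z ^ m)\<^sup>2) ^ k * z ^ m" by (simp only: power_add power_mult)
    thus ?thesis using that by simp
  qed
  thus ?thesis using assms(1,4) by (auto simp: e sols_Pair_iff has_nonreal_class_def)
qed

text \<open>The variant for even \<open>q\<close>, where the sign of \<open>z ^ m\<close> stays open
  and the descent stops at \<open>2 m\<close>.\<close>

lemma sols_if_real_classes:
  assumes "D \<in> sols N \<mu>" "\<not> has_nonreal_class m D"
  shows "D \<in> sols (m * 2) \<mu>"
  using assms by (cases D) (auto simp: sols_Pair_iff has_nonreal_class_def power_mult)

lemma cos_2pi_div_bounds:
  assumes "q \<ge> 5"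
  shows "0 < cos (2 * pi / real q)" "cos (2 * pi / real q) < 1"
proof -
  have "2 * pi / real q < pi / 2" using assms by (simp add: field_simps)
  thus "0 < cos (2 * pi / real q)" using assms by (intro cos_gt_zero_pi) (auto intro: order_less_trans[of _ 0])
  have "cos (2 * pi / real q) < cos 0"
    using assms by (intro cos_monotone_0_pi) (auto simp: field_simps)
  thus "cos (2 * pi / real q) < 1" by simp
qed

lemma Re_powers_unit:
  assumes "norm w = 1"
  shows "Re (w\<^sup>2) = 2 * (Re w)\<^sup>2 - 1" "Re (w ^ 3) = 4 * Re w ^ 3 - 3 * Re w"
proof -
  have i: "(Im w)\<^sup>2 = 1 - (Re w)\<^sup>2" using assms cmod_power2[of w] by simp
  show "Re (w\<^sup>2) = 2 * (Re w)\<^sup>2 - 1" using i by (simp add: Re_power2)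
  have "Re (w ^ 3) = Re w ^ 3 - 3 * Re w * (Im w)\<^sup>2"
    by (simp add: power3_eq_cube power2_eq_square algebra_simps)
  thus "Re (w ^ 3) = 4 * Re w ^ 3 - 3 * Re w"
    unfolding i by (simp add: power3_eq_cube power2_eq_square algebra_simps)
qed

lemma sim_sym: "sim D D' \<Longrightarrow> sim D' D"
  by (auto simp: sim_def split: prod.splits)

text \<open>Three distinct numbers with pairwise differences 1 or -1 would include two at distance
  2. Hence class sums at 1 take at most two values.\<close>

lemma unit_steps_two_eq:
  fixes a b c :: complex
  assumes "a - b \<in> {0, 1, - 1}" "a - c \<in> {0, 1, - 1}" "b - c \<in> {0, 1, - 1}"
  shows "a = b \<or> a = c \<or> b = c"
proof -
  have "\<forall>u\<in>{0, 1, - 1 :: complex}. \<forall>v\<in>{0, 1, - 1}. u - v \<in> {0, 1, - 1} \<longrightarrow> u = 0 \<or> v = 0 \<or> u = v"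
    by simp
  moreover have "a - b = (a - c) - (b - c)" by simp
  ultimately have "a - c = 0 \<or> b - c = 0 \<or> a - c = b - c"
    using assms by (simp only:)
  thus ?thesis by auto
qed

section \<open>Factors \<open>q\<close> at least 5 with at most one bad exponent
  \<open>t0\<close>\<close>

context
  fixes N q m t0 :: nat and \<mu> :: real and w :: complex
  assumes N: "N = q * m" "N > 0" and q: "q \<ge> 5"
    and cop: "\<And>t. t < q \<Longrightarrow> t \<noteq> t0 \<Longrightarrow> coprime (1 + t * m) N" and t0: "t0 < q"
    and \<mu>: "\<mu> \<noteq> 0"
  defines "w \<equiv> cis (2 * pi / real q)"
begin

text \<open>The classes of 1, \<open>w\<close> and \<open>w^2\<close> stay disjoint even after
  adding conjugates, and \<open>w\<close> and \<open>w^2\<close> are not real. With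
  \<open>r = Re w\<close>, all of this comes from \<open>0 < r < 1\<close> and
  \<open>Re (w^2) = 2 r^2 - 1\<close>.\<close>

lemma w_facts:
  "w ^ q = 1" "(w\<^sup>2) ^ q = 1" "norm w = 1" "norm (w\<^sup>2) = 1" "w\<^sup>2 \<noteq> 1" "(w\<^sup>2)\<^sup>2 \<noteq> 1"
  "Re w \<noteq> 1" "Re (w\<^sup>2) \<noteq> 1" "Re w \<noteq> Re (w\<^sup>2)"
proof -
  define r where "r = Re w"
  have r: "0 < r" "r < 1" using cos_2pi_div_bounds[OF q] by (simp_all add: r_def w_def)
  show wq: "w ^ q = 1" using q by (simp add: w_def DeMoivre)
  show "(w\<^sup>2) ^ q = 1" using wq by (metis mult.commute power_mult power_one)
  show n: "norm w = 1" by (simp add: w_def)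
  thus n2: "norm (w\<^sup>2) = 1" by (simp add: norm_power)
  have R2: "Re (w\<^sup>2) = 2 * r\<^sup>2 - 1" using Re_powers_unit(1)[OF n] by (simp add: r_def)
  have rr: "0 < r\<^sup>2" "r\<^sup>2 < 1" using r by (simp_all add: power_less_one_iff)
  show "w\<^sup>2 \<noteq> 1"
  proof
    assume "w\<^sup>2 = 1"
    thus False using R2 rr by simp
  qed
  show "(w\<^sup>2)\<^sup>2 \<noteq> 1"
  proof
    assume "(w\<^sup>2)\<^sup>2 = 1"
    hence "w\<^sup>2 = 1 \<or> w\<^sup>2 = - 1" by (rule power2_eq_1_iff[THEN iffD1])
    thus False using R2 rr by auto
  qed
  show "Re w \<noteq> 1" using r by (simp add: r_def)
  show "Re (w\<^sup>2) \<noteq> 1" using R2 rr by simp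
  have "(2 * r + 1) * (r - 1) \<noteq> 0" using r by simp
  thus "Re w \<noteq> Re (w\<^sup>2)" unfolding R2 by (simp add: r_def power2_eq_square algebra_simps)
qed

lemma diff_prop:
  assumes "\<kappa> ^ q = 1" "D \<in> sols N \<mu>" "D' \<in> sols N \<mu>"
  shows "\<kappa> ^ t0 * (class_sum m \<kappa> D - class_sum m \<kappa> D') = class_sum m 1 D - class_sum m 1 D'"
  using class_sum_diff_proportional[OF N cop t0 assms] .

text \<open>When the two vectors of class sums differ, each of the classes of $1$, $w$, $w^2$
  contains one of the four cosines, so the class of $w$ or of $w^2$ contains exactly one.\<close>

lemma class_sum_1_diff_cases:
  assumes D: "D \<in> sols N \<mu>" "D' \<in> sols N \<mu>"
  shows "class_sum m 1 D - class_sum m 1 D' \<in> {0, 1, - 1}"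
proof (cases "class_sum m 1 D = class_sum m 1 D'")
  case False
  obtain x y x' y' where e: "D = (x, y)" "D' = (x', y')" by (cases D, cases D') auto
  have n: "norm x = 1" "norm y = 1" "norm x' = 1" "norm y' = 1"
    using D N norm_eq_1_if_power_eq_1[of _ N] by (auto simp: e sols_Pair_iff)
  define h where "h = (\<lambda>\<kappa> z. Re (z ^ m) = Re \<kappa>)"
  have cover: "h \<kappa> x \<or> h \<kappa> y \<or> h \<kappa> x' \<or> h \<kappa> y'" if "\<kappa> ^ q = 1" for \<kappa>
  proof (rule ccontr)
    assume "\<not> ?thesis"
    hence "class_sum m \<kappa> D = 0" "class_sum m \<kappa> D' = 0"
      by (simp_all add: e class_sum_Pair class_part_eq_0 h_def)
    thus False using diff_prop[OF that D] False by simp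
  qed
  have disj: "\<not> (h 1 z \<and> h w z)" "\<not> (h 1 z \<and> h (w\<^sup>2) z)" "\<not> (h w z \<and> h (w\<^sup>2) z)" for z
    using w_facts(7-9) by (auto simp: h_def)
  define one where "one = (\<lambda>\<kappa>. h \<kappa> x \<and> \<not> h \<kappa> y \<and> \<not> h \<kappa> x' \<and> \<not> h \<kappa> y' \<or>
     \<not> h \<kappa> x \<and> h \<kappa> y \<and> \<not> h \<kappa> x' \<and> \<not> h \<kappa> y' \<or>
     \<not> h \<kappa> x \<and> \<not> h \<kappa> y \<and> h \<kappa> x' \<and> \<not> h \<kappa> y' \<or>
     \<not> h \<kappa> x \<and> \<not> h \<kappa> y \<and> \<not> h \<kappa> x' \<and> h \<kappa> y')"
  \<comment> \<open>Pigeonhole: two hits each for \<open>w\<close> and \<open>w^2\<close> and at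
    least one for 1 would need five cosines.\<close>
  have "one w \<or> one (w\<^sup>2)"
    using cover[of 1] cover[of w] cover[of "w\<^sup>2"] w_facts(1,2) disj[of x] disj[of y] disj[of x'] disj[of y']
    unfolding one_def power_one simp_thms by argo
  then obtain \<kappa> where \<kappa>: "\<kappa> ^ q = 1" "norm \<kappa> = 1" "\<kappa>\<^sup>2 \<noteq> 1" "one \<kappa>"
    using w_facts by blast
  \<comment> \<open>The only hit contributes a unit number. Multiplication by a power of \<kappa>
    keeps the norm, and the difference at 1 is real, hence 1 or -1.\<close>
  have "norm (class_sum m \<kappa> D - class_sum m \<kappa> D') = 1"
    using \<kappa>(4) Re_class_part_hit(2)[OF \<kappa>(2,3) n(1), of m] Re_class_part_hit(2)[OF \<kappa>(2,3) n(2), of m]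
      Re_class_part_hit(2)[OF \<kappa>(2,3) n(3), of m] Re_class_part_hit(2)[OF \<kappa>(2,3) n(4), of m]
      class_part_eq_0[of x m \<kappa>] class_part_eq_0[of y m \<kappa>] class_part_eq_0[of x' m \<kappa>] class_part_eq_0[of y' m \<kappa>]
    unfolding one_def h_def e class_sum_Pair by auto
  hence "norm (\<kappa> ^ t0 * (class_sum m \<kappa> D - class_sum m \<kappa> D')) = 1"
    using \<kappa>(2) by (simp add: norm_mult norm_power)
  hence "norm (class_sum m 1 D - class_sum m 1 D') = 1"
    unfolding diff_prop[OF \<kappa>(1) D] .
  moreover obtain c where "class_sum m 1 D - class_sum m 1 D' = of_real c"
    using class_sum_1_real Reals_diff Reals_cases by metis
  ultimately show ?thesis by (auto simp: abs_if split: if_splits)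
qed simp

lemma class_sum_eq_if_class_sum_1_eq:
  assumes "\<kappa> ^ q = 1" "D \<in> sols N \<mu>" "D' \<in> sols N \<mu>" "class_sum m 1 D = class_sum m 1 D'"
  shows "class_sum m \<kappa> D = class_sum m \<kappa> D'"
proof -
  have "\<kappa> \<noteq> 0" using assms(1) q by (auto simp: power_0_left)
  thus ?thesis using diff_prop[OF assms(1-3)] assms(4) by simp
qed

lemma class_sum_level_m:
  assumes "D \<in> sols m \<mu>" "\<kappa> \<noteq> 1"
  shows "class_sum m \<kappa> D = 0"
proof -
  have "class_part m \<kappa> z = 0" if "z ^ m = 1" for z
    using that assms(2) by (simp add: class_part_def flip: complex_cnj_power)
  thus ?thesis using assms(1) by (cases D) (simp add: sols_Pair_iff class_sum_Pair)
qed

text \<open>Equal sums at 1 would force equal sums everywhere, but at some non-real \<kappa> only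
  \<open>D\<close> has a non-zero sum.\<close>

lemma class_sum_1_neq_level_m:
  assumes "D \<in> sols N \<mu>" "has_nonreal_class m D" "D' \<in> sols N \<mu>" "D' \<in> sols m \<mu>"
  shows "class_sum m 1 D \<noteq> class_sum m 1 D'"
proof
  assume eq: "class_sum m 1 D = class_sum m 1 D'"
  obtain \<kappa> where \<kappa>: "\<kappa> ^ q = 1" "norm \<kappa> = 1" "\<kappa>\<^sup>2 \<noteq> 1" "class_sum m \<kappa> D \<noteq> 0"
    using nonreal_class_sum_neq_0[OF assms(1) N \<mu> assms(2)] .
  have "\<kappa> \<noteq> 1" using \<kappa>(3) by auto
  thus False
    using class_sum_eq_if_class_sum_1_eq[OF \<kappa>(1) assms(1,3) eq] class_sum_level_m[OF assms(4)] \<kappa>(4)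
    by simp
qed

text \<open>\<open>D'\<close> contributes to the class of 1 only, so the non-zero difference at
  \<kappa> has to come from \<open>x\<close> or \<open>y\<close>.\<close>

lemma class_hit_if_level_m:
  assumes "(x, y) \<in> sols N \<mu>" "has_nonreal_class m (x, y)" "D' \<in> sols N \<mu>" "D' \<in> sols m \<mu>" "\<kappa> ^ q = 1" "\<kappa> \<noteq> 1"
  shows "Re (x ^ m) = Re \<kappa> \<or> Re (y ^ m) = Re \<kappa>"
proof (rule ccontr)
  assume "\<not> ?thesis"
  hence "class_sum m \<kappa> (x, y) = 0" by (simp add: class_sum_Pair class_part_eq_0)
  thus False
    using diff_prop[OF assms(5,1,3)] class_sum_1_neq_level_m[OF assms(1-4)] class_sum_level_m[OF assms(4,6)]
    by simp
qed

text \<open>The disjoint classes of \<open>w\<close> and \<open>w^2\<close> must both be hit, so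
  \<open>x\<close> and \<open>y\<close> hit one each and the class sum at \<open>w\<close> is a
  single root.\<close>

lemma Re_class_sum_if_level_m:
  assumes D: "(x, y) \<in> sols N \<mu>" "has_nonreal_class m (x, y)" "D' \<in> sols N \<mu>" "D' \<in> sols m \<mu>"
  shows "Re (class_sum m w (x, y)) \<in> {Re x, Re y}"
proof -
  have n: "norm x = 1" "norm y = 1"
    using D N norm_eq_1_if_power_eq_1[of _ N] by (auto simp: sols_Pair_iff)
  have "w \<noteq> 1" "w\<^sup>2 \<noteq> 1" using w_facts(7,8) by auto
  hence "Re (x ^ m) = Re w \<or> Re (y ^ m) = Re w" "Re (x ^ m) = Re (w\<^sup>2) \<or> Re (y ^ m) = Re (w\<^sup>2)"
    using class_hit_if_level_m[OF D] w_facts(1,2) by blast+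
  then consider "Re (x ^ m) = Re w" "Re (y ^ m) \<noteq> Re w" | "Re (x ^ m) \<noteq> Re w" "Re (y ^ m) = Re w"
    using w_facts(9) by auto
  thus ?thesis
  proof cases
    case 1
    thus ?thesis using Re_class_part_hit(1)[OF w_facts(3,5) n(1) 1(1)] class_part_eq_0[of y m w]
      by (simp add: class_sum_Pair)
  next
    case 2
    thus ?thesis using Re_class_part_hit(1)[OF w_facts(3,5) n(2) 2(2)] class_part_eq_0[of x m w]
      by (simp add: class_sum_Pair)
  qed
qed

text \<open>For \<open>q\<close> at least 7 the numbers \<open>w\<close>, \<open>w^2\<close>,
  \<open>w^3\<close> have different real parts, so two cosines would have to hit three disjoint
  classes.\<close>

lemma no_level_m_if_nonreal:
  assumes D: "D \<in> sols N \<mu>" "has_nonreal_class m D" "D' \<in> sols N \<mu>" "D' \<in> sols m \<mu>" and q7: "q \<ge> 7"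
  shows False
proof -
  obtain x y where e: "D = (x, y)" by (cases D)
  define r where "r = Re w"
  have r: "1 / 2 < r" "r < 1"
  proof -
    have "cos (pi / 3) < cos (2 * pi / real q)"
      using q7 by (intro cos_monotone_0_pi) (auto simp: field_simps)
    thus "1 / 2 < r" by (simp add: r_def w_def cos_60)
    show "r < 1" using cos_2pi_div_bounds[OF q] by (simp add: r_def w_def)
  qed
  have R2: "Re (w\<^sup>2) = 2 * r\<^sup>2 - 1" and R3: "Re (w ^ 3) = 4 * r ^ 3 - 3 * r"
    using Re_powers_unit[OF w_facts(3)] by (simp_all add: r_def)
  have "(r - 1) * (2 * r + 1) ^ 2 \<noteq> 0" using r by simp
  hence a: "Re (w ^ 3) \<noteq> 1"
    unfolding R3 by (simp add: power2_eq_square power3_eq_cube algebra_simps)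
  have "r * ((r - 1) * (r + 1)) \<noteq> 0" using r by simp
  hence b: "Re (w ^ 3) \<noteq> Re w"
    unfolding R3 r_def[symmetric] by (simp add: power3_eq_cube algebra_simps)
  \<comment> \<open>The factor \<open>4 r^2 + 2 r - 1\<close> vanishes at
    \<open>r = cos (2 * pi / 5)\<close>: for \<open>q = 5\<close>, \<open>w^3\<close> is the
    conjugate of \<open>w^2\<close>.\<close>
  have "4 * r\<^sup>2 \<ge> 0" by simp
  hence "4 * r\<^sup>2 + 2 * r - 1 > 0" using r by linarith
  hence "(r - 1) * (4 * r\<^sup>2 + 2 * r - 1) \<noteq> 0" using r by simp
  hence c: "Re (w ^ 3) \<noteq> Re (w\<^sup>2)"
    unfolding R3 R2 by (simp add: power2_eq_square power3_eq_cube algebra_simps)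
  have "(w ^ 3) ^ q = 1" using w_facts(1) by (metis mult.commute power_mult power_one)
  moreover have "w \<noteq> 1" "w\<^sup>2 \<noteq> 1" "w ^ 3 \<noteq> 1" using w_facts(7,8) a by auto
  ultimately have "Re (x ^ m) = Re \<kappa> \<or> Re (y ^ m) = Re \<kappa>" if "\<kappa> \<in> {w, w\<^sup>2, w ^ 3}" for \<kappa>
    using class_hit_if_level_m[OF D[unfolded e], of \<kappa>] w_facts(1,2) that by auto
  from this[of w] this[of "w\<^sup>2"] this[of "w ^ 3"] show False
    using w_facts(9) b c by auto
qed

text \<open>The sums of \<open>D1\<close> and \<open>D2\<close> at 1 both differ from that of
  \<open>D'\<close>, so they agree. Then the sums at \<open>w\<close> agree too, and their real part
  is common to both solutions.\<close>

lemma sim_if_nonreal_and_level_m: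
  assumes D: "D1 \<in> sols N \<mu>" "has_nonreal_class m D1" "D2 \<in> sols N \<mu>" "has_nonreal_class m D2" and D': "D' \<in> sols N \<mu>" "D' \<in> sols m \<mu>"
  shows "sim D1 D2"
proof -
  obtain x1 y1 x2 y2 where e: "D1 = (x1, y1)" "D2 = (x2, y2)" by (cases D1, cases D2) auto
  have "class_sum m 1 D1 = class_sum m 1 D2"
    using unit_steps_two_eq[OF class_sum_1_diff_cases[OF D(1,3)] class_sum_1_diff_cases[OF D(1) D'(1)]
      class_sum_1_diff_cases[OF D(3) D'(1)]]
      class_sum_1_neq_level_m[OF D(1,2) D'] class_sum_1_neq_level_m[OF D(3,4) D'] by blast
  hence "class_sum m w D1 = class_sum m w D2"
    by (rule class_sum_eq_if_class_sum_1_eq[OF w_facts(1) D(1,3)])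
  thus ?thesis
    using Re_class_sum_if_level_m[OF D(1,2)[unfolded e] D'] Re_class_sum_if_level_m[OF D(3,4)[unfolded e] D']
      sols_simI[OF D(1,3)[unfolded e]] e by simp
qed

lemma class_sum_1_eq_two:
  assumes D: "(x, y) \<in> sols N \<mu>" "(x', y') \<in> sols N \<mu>" "\<not> sim (x, y) (x', y')" and "has_nonreal_class m (x, y)"
    and "class_sum m 1 (x, y) = class_sum m 1 (x', y')"
  shows "\<mu> / 2 \<in> {Re x, Re y} \<longleftrightarrow> \<mu> / 2 \<notin> {Re x', Re y'}"
proof -
  obtain \<kappa> where \<kappa>: "\<kappa> ^ q = 1" "norm \<kappa> = 1" "\<kappa>\<^sup>2 \<noteq> 1" "class_sum m \<kappa> (x, y) \<noteq> 0"
    using nonreal_class_sum_neq_0[OF D(1) N \<mu> assms(4)] .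
  show ?thesis
    using class_sum_eq_two[OF N(2) \<kappa>(2,3) D refl
        class_sum_eq_if_class_sum_1_eq[OF \<kappa>(1) D(1,2) assms(5), symmetric] \<kappa>(4)] by metis
qed

lemma class_sum_1_eq_three:
  assumes D: "D1 \<in> sols N \<mu>" "D2 \<in> sols N \<mu>" "D3 \<in> sols N \<mu>"
      "\<not> sim D1 D2" "\<not> sim D1 D3" "\<not> sim D2 D3" and "has_nonreal_class m D1"
    and eq: "class_sum m 1 D1 = class_sum m 1 D2" "class_sum m 1 D1 = class_sum m 1 D3"
  shows False
proof -
  obtain \<kappa> where \<kappa>: "\<kappa> ^ q = 1" "norm \<kappa> = 1" "\<kappa>\<^sup>2 \<noteq> 1" "class_sum m \<kappa> D1 \<noteq> 0"
    using nonreal_class_sum_neq_0[OF D(1) N \<mu> assms(7)] .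
  note eqs = class_sum_eq_if_class_sum_1_eq[OF \<kappa>(1) D(1,2) eq(1), symmetric]
    class_sum_eq_if_class_sum_1_eq[OF \<kappa>(1) D(1,3) eq(2), symmetric]
  show False
    using class_sum_eq_three[OF N(2) \<kappa>(2,3) D refl eqs \<kappa>(4)] .
qed

text \<open>Two inequivalent solutions with equal class sums force one of them to be $\{\mu/2, 0\}$ (as real
  parts), and this cannot happen for two different vectors of class sums.\<close>

lemma no_two_and_two:
  assumes D: "D1 \<in> sols N \<mu>" "D2 \<in> sols N \<mu>" "D3 \<in> sols N \<mu>" "D4 \<in> sols N \<mu>"
      "\<not> sim D1 D2" "\<not> sim D1 D3" "\<not> sim D1 D4" "\<not> sim D2 D3" "\<not> sim D2 D4" "\<not> sim D3 D4"
    and b: "has_nonreal_class m D1" "has_nonreal_class m D3"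
    and eq: "class_sum m 1 D1 = class_sum m 1 D2" "class_sum m 1 D3 = class_sum m 1 D4"
  shows False
proof -
  obtain x1 y1 x2 y2 x3 y3 x4 y4
    where e: "D1 = (x1, y1)" "D2 = (x2, y2)" "D3 = (x3, y3)" "D4 = (x4, y4)" by (metis surj_pair)
  have "\<mu> / 2 \<in> {Re x1, Re y1} \<or> \<mu> / 2 \<in> {Re x2, Re y2}"
    using class_sum_1_eq_two[OF D(1,2,5)[unfolded e] b(1)[unfolded e] eq(1)[unfolded e]] by blast
  moreover have "\<mu> / 2 \<in> {Re x3, Re y3} \<or> \<mu> / 2 \<in> {Re x4, Re y4}"
    using class_sum_1_eq_two[OF D(3,4,10)[unfolded e] b(2)[unfolded e] eq(2)[unfolded e]] by blast
  moreover have "\<not> (\<mu> / 2 \<in> {Re x, Re y} \<and> \<mu> / 2 \<in> {Re x', Re y'})"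
    if "(x, y) \<in> {D1, D2}" "(x', y') \<in> {D3, D4}" for x y x' y'
  proof -
    have "(x, y) \<in> sols N \<mu>" "(x', y') \<in> sols N \<mu>" "\<not> sim (x, y) (x', y')"
      using that D by auto
    thus ?thesis using sols_simI by blast
  qed
  ultimately show False using e by blast
qed

text \<open>The sums at 1 take at most two values and no value is taken three times. The remaining
  split into two and two is excluded by \<open>no_two_and_two\<close>.\<close>

lemma no_four_if_all_nonreal:
  assumes D: "D1 \<in> sols N \<mu>" "D2 \<in> sols N \<mu>" "D3 \<in> sols N \<mu>" "D4 \<in> sols N \<mu>"
      "\<not> sim D1 D2" "\<not> sim D1 D3" "\<not> sim D1 D4" "\<not> sim D2 D3" "\<not> sim D2 D4" "\<not> sim D3 D4"
    and b: "has_nonreal_class m D1" "has_nonreal_class m D2" "has_nonreal_class m D3" "has_nonreal_class m D4"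
  shows False
proof -
  define s where "s = class_sum m 1"
  note d = class_sum_1_diff_cases
  have t: "s A = s B \<or> s A = s C \<or> s B = s C" if "A \<in> sols N \<mu>" "B \<in> sols N \<mu>" "C \<in> sols N \<mu>" for A B C
    unfolding s_def by (rule unit_steps_two_eq[OF d[OF that(1,2)] d[OF that(1,3)] d[OF that(2,3)]])
  have three: "\<not> (s D1 = s D2 \<and> s D1 = s D3)" "\<not> (s D1 = s D2 \<and> s D1 = s D4)"
    "\<not> (s D1 = s D3 \<and> s D1 = s D4)" "\<not> (s D2 = s D3 \<and> s D2 = s D4)"
    using class_sum_1_eq_three[OF D(1,2,3,5,6,8) b(1)] class_sum_1_eq_three[OF D(1,2,4,5,7,9) b(1)]
      class_sum_1_eq_three[OF D(1,3,4,6,7,10) b(1)] class_sum_1_eq_three[OF D(2,3,4,8,9,10) b(2)]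
    unfolding s_def by blast+
  have r: "\<not> sim D3 D2" "\<not> sim D4 D2" "\<not> sim D4 D3" using D(8-10) sim_sym by blast+
  have two: "\<not> (s D1 = s D2 \<and> s D3 = s D4)" "\<not> (s D1 = s D3 \<and> s D2 = s D4)" "\<not> (s D1 = s D4 \<and> s D2 = s D3)"
    using no_two_and_two[OF D b(1,3)] no_two_and_two[OF D(1,3,2,4,6,5,7) r(1) D(10,9) b(1,2)]
      no_two_and_two[OF D(1,4,2,3,7,5,6) r(2,3) D(8) b(1,2)]
    unfolding s_def by blast+
  show False
    using t[OF D(1,2,3)] t[OF D(1,2,4)] t[OF D(1,3,4)] t[OF D(2,3,4)] three two by (smt (verit))
qed

text \<open>If some solution already lives at level \<open>m\<close>, then \<open>q < 7\<close> and
  every solution with a non-real class is similar to \<open>D1\<close>. So the other three are at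
  level \<open>m\<close>, against \<open>level_m\<close>.\<close>

lemma no_four_if_nonreal:
  assumes D: "D1 \<in> sols N \<mu>" "D2 \<in> sols N \<mu>" "D3 \<in> sols N \<mu>" "D4 \<in> sols N \<mu>"
      "\<not> sim D1 D2" "\<not> sim D1 D3" "\<not> sim D1 D4" "\<not> sim D2 D3" "\<not> sim D2 D4" "\<not> sim D3 D4"
    and b: "has_nonreal_class m D1" and odd: "odd q"
    and level_m: "\<And>D1 D2 D3. q < 7 \<Longrightarrow> D1 \<in> sols m \<mu> \<Longrightarrow> D2 \<in> sols m \<mu> \<Longrightarrow> D3 \<in> sols m \<mu> \<Longrightarrow>
      sim D1 D2 \<or> sim D1 D3 \<or> sim D2 D3"
  shows False
proof (cases "has_nonreal_class m D2 \<and> has_nonreal_class m D3 \<and> has_nonreal_class m D4")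
  case True
  thus False using no_four_if_all_nonreal[OF D b] by blast
next
  case False
  note lev = sols_if_real_classes_odd[OF _ N(1) odd]
  obtain D' where D': "D' \<in> sols N \<mu>" "D' \<in> sols m \<mu>"
    using False D(2-4) lev by blast
  have "q < 7" using no_level_m_if_nonreal[OF D(1) b D'] by (meson not_le)
  moreover have "\<not> has_nonreal_class m D2" "\<not> has_nonreal_class m D3" "\<not> has_nonreal_class m D4"
    using sim_if_nonreal_and_level_m[OF D(1) b _ _ D'] D by blast+
  ultimately show False
    using level_m[of D2 D3 D4] lev D by blast
qed

end

section \<open>Roots of unity of order dividing 12\<close>

lemma not_coprime_nat_prime_common:
  fixes a b :: nat
  assumes "\<not> coprime a b"
  shows "\<exists>p. prime p \<and> p dvd a \<and> p dvd b"
proof -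
  have "gcd a b \<noteq> 1" using assms by (simp add: coprime_iff_gcd_eq_1)
  then obtain p where "prime p" "p dvd gcd a b" using prime_factor_nat by blast
  thus ?thesis by auto
qed

lemma coprime_1_plus_mult:
  fixes q m t :: nat
  assumes "\<And>p. prime p \<Longrightarrow> p dvd q \<Longrightarrow> p dvd m"
  shows "coprime (1 + t * m) (q * m)"
proof (rule ccontr)
  assume "\<not> ?thesis"
  then obtain p where p: "prime p" "p dvd 1 + t * m" "p dvd q * m"
    by (meson not_coprime_nat_prime_common)
  hence "p dvd m" using assms prime_dvd_mult_iff by blast
  hence "p dvd 1" using p(2) by (metis dvd_add_left_iff dvd_mult)
  thus False using p(1) by auto
qed

text \<open>As \<open>m\<close> is invertible modulo \<open>p\<close>, at most one
  \<open>t < p\<close> makes \<open>p\<close> divide \<open>1 + t * m\<close>; a prime factor of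
  \<open>m\<close> never does.\<close>

lemma coprime_1_plus_mult_prime:
  fixes p m :: nat
  assumes "prime p" "\<not> p dvd m"
  obtains t0 where "t0 < p" "\<And>t. t < p \<Longrightarrow> t \<noteq> t0 \<Longrightarrow> coprime (1 + t * m) (p * m)"
proof -
  have cop: "coprime m p" using prime_imp_coprime[OF assms] by (simp add: coprime_commute)
  have inj: "t = t'" if "t < p" "t' < p" "p dvd 1 + t * m" "p dvd 1 + t' * m" for t t'
  proof -
    have "[1 + t * m = 1 + t' * m] (mod p)" using that by (simp add: cong_def mod_0_imp_dvd dvd_imp_mod_0)
    hence "[t * m = t' * m] (mod p)" using cong_add_lcancel_nat by blast
    hence "[t = t'] (mod p)" using cong_mult_rcancel_nat[OF cop] by blast
    thus ?thesis using that cong_less_modulus_unique_nat by blast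
  qed
  have c: "coprime (1 + t * m) (p * m)" if "\<not> p dvd 1 + t * m" for t
  proof (rule ccontr)
    assume "\<not> ?thesis"
    then obtain r where r: "prime r" "r dvd 1 + t * m" "r dvd p * m"
      by (meson not_coprime_nat_prime_common)
    moreover have "\<not> r dvd p" using r that assms(1) primes_dvd_imp_eq by blast
    ultimately have "r dvd m" using prime_dvd_mult_iff by blast
    hence "r dvd 1" using r(2) by (metis dvd_add_left_iff dvd_mult)
    thus False using r(1) by auto
  qed
  show ?thesis
  proof (cases "\<exists>t<p. p dvd 1 + t * m")
    case True
    then obtain t0 where "t0 < p" "p dvd 1 + t0 * m" by blast
    thus ?thesis using that[of t0] inj c by blast
  next
    case False
    \<comment> \<open>With no exponent to exclude, 0 serves as a default for
      \<open>t0\<close>.\<close>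
    thus ?thesis using that[of 0] c assms(1) prime_gt_0_nat by blast
  qed
qed

text \<open>Irrationality of the square root of 3 in a bounded range, where
  \<open>d^2 = 3 e^2\<close> with \<open>e\<close> at most 4 is a finite check. The bound 4 fits
  four coefficients of absolute value at most 1.\<close>

lemma int_combination_sqrt3_unique:
  fixes a b a' b' :: int
  assumes "a + b * sqrt 3 = a' + b' * sqrt 3" "\<bar>b - b'\<bar> \<le> 4"
  shows "a = a'" "b = b'"
proof -
  have "real_of_int (a - a') = (b' - b) * sqrt 3" using assms(1) by (simp add: algebra_simps)
  hence "(real_of_int (a - a'))\<^sup>2 = 3 * (real_of_int (b' - b))\<^sup>2" by (simp add: power_mult_distrib)
  hence sq: "(a - a')\<^sup>2 = 3 * (b' - b)\<^sup>2" by (metis of_int_eq_iff of_int_mult of_int_numeral of_int_power)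
  define d where "d = nat \<bar>a - a'\<bar>"
  define e where "e = nat \<bar>b' - b\<bar>"
  have "int (d\<^sup>2) = int (3 * e\<^sup>2)" using sq by (simp add: d_def e_def)
  hence de: "d\<^sup>2 = 3 * e\<^sup>2" by linarith
  have "e \<in> {0, 1, 2, 3, 4}" using assms(2) by (auto simp: e_def)
  moreover have "d < 7"
  proof (rule ccontr)
    assume "\<not> d < 7"
    hence "7\<^sup>2 \<le> d\<^sup>2" by (intro power_mono) auto
    moreover have "e\<^sup>2 \<le> 4\<^sup>2" using \<open>e \<in> _\<close> by (intro power_mono) auto
    ultimately show False using de by simp
  qed
  hence "d \<in> {0, 1, 2, 3, 4, 5, 6}" by auto
  ultimately have "e = 0" using de by auto
  thus "b = b'" by (simp add: e_def)
  thus "a = a'" using assms(1) by simp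
qed

text \<open>Factor \<open>z ^ 12 - 1\<close> into cyclotomic polynomials. With
  \<open>r = 2 * Re z\<close> and \<open>z^2 = r z - 1\<close>, each factor of degree at least 2
  becomes a polynomial in \<open>r\<close> times a power of \<open>z\<close>, the last one giving
  \<open>r^2 = 3\<close>.\<close>

lemma Re_12th_root_of_unity:
  fixes z :: complex
  assumes "z ^ 12 = 1" "Re z \<noteq> 0"
  shows "\<exists>(a, b) \<in> {(1, 0), (-1, 0), (2, 0), (-2, 0), (0, 1), (0, -1)}.
    2 * Re z = real_of_int a + real_of_int b * sqrt 3"
proof -
  define r where "r = complex_of_real (2 * Re z)"
  have "norm z = 1" using norm_eq_1_if_power_eq_1[OF assms(1)] by simp
  hence "z * cnj z = 1" using complex_norm_square[of z] by simp
  moreover have "z + cnj z = r" by (simp add: r_def complex_add_cnj)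
  hence "r * z = z\<^sup>2 + z * cnj z" by (simp add: power2_eq_square algebra_simps flip: \<open>z + cnj z = r\<close>)
  ultimately have z2: "z\<^sup>2 = r * z - 1" by simp
  have "0 = z ^ 12 - 1" using assms(1) by simp
  also have "z ^ 12 - 1 = (z - 1) * (z + 1) * (z\<^sup>2 + 1) * (z\<^sup>2 + z + 1) * (z\<^sup>2 - z + 1) * (z\<^sup>2 * z\<^sup>2 - z\<^sup>2 + 1)"
    by (simp add: algebra_simps power_numeral_reduce)
  also have "z\<^sup>2 * z\<^sup>2 - z\<^sup>2 + 1 = z\<^sup>2 * (r\<^sup>2 - 3)"
  proof -
    have "z\<^sup>2 * z\<^sup>2 - z\<^sup>2 + 1 = (z\<^sup>2 + 1)\<^sup>2 - 3 * z\<^sup>2" by (simp add: algebra_simps power2_eq_square)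
    also have "z\<^sup>2 + 1 = r * z" by (simp add: z2)
    finally show ?thesis by (simp add: algebra_simps)
  qed
  also have "z\<^sup>2 + 1 = r * z" by (simp add: z2)
  also have "z\<^sup>2 + z + 1 = (r + 1) * z" by (simp add: z2 algebra_simps)
  also have "z\<^sup>2 - z + 1 = (r - 1) * z" by (simp add: z2 algebra_simps)
  finally have "z = 1 \<or> z = -1 \<or> r = 0 \<or> r = -1 \<or> r = 1 \<or> r\<^sup>2 = 3"
    using assms(1) by (auto simp: eq_neg_iff_add_eq_0)
  moreover have "2 * Re z = sqrt 3 \<or> 2 * Re z = - sqrt 3" if "r\<^sup>2 = 3"
  proof -
    have "complex_of_real ((2 * Re z)\<^sup>2) = of_real 3" using that by (simp add: r_def)
    hence "(2 * Re z)\<^sup>2 = (sqrt 3)\<^sup>2" unfolding of_real_eq_iff by simp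
    thus ?thesis by (simp only: power2_eq_iff)
  qed
  moreover have "2 * Re z = -1" if "r = -1" using that unfolding r_def by (metis of_real_1 of_real_minus of_real_eq_iff)
  moreover have "2 * Re z = 1" if "r = 1" using that unfolding r_def by (metis of_real_1 of_real_eq_iff)
  moreover have "r \<noteq> 0" using assms(2) by (simp add: r_def)
  ultimately show ?thesis by auto
qed

text \<open>A non-zero sum of two of the values 1, -1, 2, -2 and plus or minus the square root of 3
  determines its summands. The value 0 is set apart because \<open>0 + 1 = 2 + (-1)\<close>.\<close>

lemma sols_12_zero_or_sim:
  assumes D: "(x, y) \<in> sols 12 \<mu>" "(x', y') \<in> sols 12 \<mu>" and "\<mu> \<noteq> 0"
    and nz: "0 \<notin> {Re x, Re y}" "0 \<notin> {Re x', Re y'}"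
  shows "sim (x, y) (x', y')"
proof -
  define W :: "(int \<times> int) set" where "W = {(1, 0), (-1, 0), (2, 0), (-2, 0), (0, 1), (0, -1)}"
  define ev where "ev = (\<lambda>(a, b). real_of_int a + real_of_int b * sqrt 3)"
  have rep: "\<exists>p\<in>W. 2 * Re z = ev p" if "z ^ 12 = 1" "Re z \<noteq> 0" for z
    using Re_12th_root_of_unity[OF that] by (auto simp: W_def ev_def)
  obtain p1 where 1: "p1 \<in> W" "2 * Re x = ev p1" using rep[of x] D nz by (auto simp: sols_Pair_iff)
  obtain p2 where 2: "p2 \<in> W" "2 * Re y = ev p2" using rep[of y] D nz by (auto simp: sols_Pair_iff)
  obtain p3 where 3: "p3 \<in> W" "2 * Re x' = ev p3" using rep[of x'] D nz by (auto simp: sols_Pair_iff)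
  obtain p4 where 4: "p4 \<in> W" "2 * Re y' = ev p4" using rep[of y'] D nz by (auto simp: sols_Pair_iff)
  note p = 1(1) 2(1) 3(1) 4(1) 1(2) 2(2) 3(2) 4(2)
  have sum: "ev p1 + ev p2 = ev p3 + ev p4" "ev p1 + ev p2 \<noteq> 0"
    using D \<open>\<mu> \<noteq> 0\<close> p by (auto simp: sols_Pair_iff)
  obtain a1 b1 a2 b2 a3 b3 a4 b4 where e: "p1 = (a1, b1)" "p2 = (a2, b2)" "p3 = (a3, b3)" "p4 = (a4, b4)"
    by (metis surj_pair)
  have W1: "\<bar>snd p\<bar> \<le> 1" if "p \<in> W" for p using that by (auto simp: W_def)
  have bs: "\<bar>b1\<bar> \<le> 1" "\<bar>b2\<bar> \<le> 1" "\<bar>b3\<bar> \<le> 1" "\<bar>b4\<bar> \<le> 1"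
    using W1[OF p(1)] W1[OF p(2)] W1[OF p(3)] W1[OF p(4)] by (simp_all add: e)
  have eq: "real_of_int (a1 + a2) + real_of_int (b1 + b2) * sqrt 3 = real_of_int (a3 + a4) + real_of_int (b3 + b4) * sqrt 3"
    using sum(1) by (simp add: ev_def e algebra_simps)
  have "\<bar>b1 + b2 - (b3 + b4)\<bar> \<le> 4" using bs by linarith
  note i = int_combination_sqrt3_unique[OF eq this]
  have ne0: "\<not> (a1 + a2 = 0 \<and> b1 + b2 = 0)"
  proof
    assume "a1 + a2 = 0 \<and> b1 + b2 = 0"
    moreover have "ev p1 + ev p2 = real_of_int (a1 + a2) + real_of_int (b1 + b2) * sqrt 3"
      by (simp add: ev_def e algebra_simps)
    ultimately show False using sum(2) by simp
  qed
  \<comment> \<open>Replacing the square root of 3 by 10 turns the claim into a finite check on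
    integers; 10 is large enough to create no new coincidences.\<close>
  define code where "code = (\<lambda>(a, b). a + 10 * b :: int)"
  define C :: "int set" where "C = {1, - 1, 2, - 2, 10, - 10}"
  have inC: "code p \<in> C" if "p \<in> W" for p using that by (auto simp: W_def code_def C_def)
  have inj: "p = p'" if "p \<in> W" "p' \<in> W" "code p = code p'" for p p'
    using that unfolding W_def by (elim insertE emptyE) (simp_all add: code_def)
  have zero: "fst p + fst p' = 0 \<and> snd p + snd p' = 0"
    if "p \<in> W" "p' \<in> W" "code p + code p' = 0" for p p'
    using that unfolding W_def by (elim insertE emptyE) (simp_all add: code_def)
  have cne: "code p1 + code p2 \<noteq> 0" using zero[OF p(1,2)] ne0 by (auto simp: e)
  have csum: "code p1 + code p2 = code p3 + code p4"
  proof -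
    have "code p1 + code p2 = (a1 + a2) + 10 * (b1 + b2)" by (simp add: code_def e)
    also have "\<dots> = code p3 + code p4" unfolding i by (simp add: code_def e)
    finally show ?thesis .
  qed
  have C: "\<forall>v\<in>C. \<forall>w\<in>C. \<forall>v'\<in>C. v + w \<noteq> 0 \<longrightarrow> v + w - v' \<in> C \<longrightarrow> v' = v \<or> v' = w"
    unfolding C_def by simp
  have "code p1 + code p2 - code p3 \<in> C" using inC[OF p(4)] csum by simp
  hence "code p3 = code p1 \<or> code p3 = code p2"
    using C inC[OF p(1)] inC[OF p(2)] inC[OF p(3)] cne by simp
  hence "code p3 = code p1 \<and> code p4 = code p2 \<or> code p3 = code p2 \<and> code p4 = code p1"
    using csum by auto
  hence "p3 = p1 \<and> p4 = p2 \<or> p3 = p2 \<and> p4 = p1"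
    using inj p(1-4) by blast
  thus ?thesis using p(5-8) by (auto simp: sim_def)
qed

text \<open>Solutions with a vanishing real part are all similar, and so are those without one;
  three solutions cannot avoid both cases.\<close>

lemma no_three_12:
  assumes "D1 \<in> sols 12 \<mu>" "D2 \<in> sols 12 \<mu>" "D3 \<in> sols 12 \<mu>" "\<mu> \<noteq> 0"
  shows "sim D1 D2 \<or> sim D1 D3 \<or> sim D2 D3"
proof -
  obtain x1 y1 x2 y2 x3 y3 where e: "D1 = (x1, y1)" "D2 = (x2, y2)" "D3 = (x3, y3)" by (metis surj_pair)
  show ?thesis
    using sols_12_zero_or_sim[OF assms(1,2,4)[unfolded e]] sols_12_zero_or_sim[OF assms(1,3,4)[unfolded e]]
      sols_12_zero_or_sim[OF assms(2,3,4)[unfolded e]] sols_simI[OF assms(1,2)[unfolded e], of 0]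
      sols_simI[OF assms(1,3)[unfolded e], of 0] sols_simI[OF assms(2,3)[unfolded e], of 0]
    unfolding e by blast
qed

section \<open>At most three inequivalent solutions\<close>

definition inequivalent_four :: "nat \<Rightarrow> real \<Rightarrow> complex \<times> complex \<Rightarrow> complex \<times> complex \<Rightarrow>
    complex \<times> complex \<Rightarrow> complex \<times> complex \<Rightarrow> bool" where
  "inequivalent_four N \<mu> D1 D2 D3 D4 \<longleftrightarrow> {D1, D2, D3, D4} \<subseteq> sols N \<mu> \<and>
     \<not> sim D1 D2 \<and> \<not> sim D1 D3 \<and> \<not> sim D1 D4 \<and> \<not> sim D2 D3 \<and> \<not> sim D2 D4 \<and> \<not> sim D3 D4"

text \<open>The second hypothesis speaks of the first solution of a quadruple; permuting the
  quadruple extends it to all four.\<close>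

lemma inequivalent_four_real_classes:
  assumes D: "inequivalent_four N \<mu> D1 D2 D3 D4"
    and "\<And>D1 D2 D3 D4. inequivalent_four N \<mu> D1 D2 D3 D4 \<Longrightarrow> \<not> has_nonreal_class m D1"
    and level: "\<And>D. D \<in> sols N \<mu> \<Longrightarrow> \<not> has_nonreal_class m D \<Longrightarrow> D \<in> sols M \<mu>"
  shows "inequivalent_four M \<mu> D1 D2 D3 D4"
proof -
  have sols: "D1 \<in> sols N \<mu>" "D2 \<in> sols N \<mu>" "D3 \<in> sols N \<mu>" "D4 \<in> sols N \<mu>"
    and ns: "\<not> sim D1 D2" "\<not> sim D1 D3" "\<not> sim D1 D4" "\<not> sim D2 D3" "\<not> sim D2 D4" "\<not> sim D3 D4"
    using D by (simp_all add: inequivalent_four_def)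
  have ns': "\<not> sim D2 D1" "\<not> sim D3 D1" "\<not> sim D4 D1" "\<not> sim D3 D2" "\<not> sim D4 D2" "\<not> sim D4 D3"
    using ns sim_sym by metis+
  have "inequivalent_four N \<mu> D2 D1 D3 D4" "inequivalent_four N \<mu> D3 D1 D2 D4" "inequivalent_four N \<mu> D4 D1 D2 D3"
    using sols ns ns' by (simp_all add: inequivalent_four_def)
  note nb = assms(2)[OF D] this[THEN assms(2)]
  show ?thesis
    using level[OF sols(1) nb(1)] level[OF sols(2) nb(2)] level[OF sols(3) nb(3)] level[OF sols(4) nb(4)] ns
    by (simp add: inequivalent_four_def)
qed

text \<open>\<open>M\<close> is kept apart from \<open>m\<close>, since the descent ends at
  \<open>m\<close> for odd \<open>q\<close> but at \<open>2 m\<close> for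
  \<open>q = 4\<close>.\<close>

lemma inequivalent_four_reduce:
  assumes D: "inequivalent_four N \<mu> D1 D2 D3 D4" and N: "N = q * m" "N > 0" "q > 1" and "\<mu> \<noteq> 0"
    and div: "\<And>p. prime p \<Longrightarrow> p dvd q \<Longrightarrow> p dvd m"
    and level: "\<And>D. D \<in> sols N \<mu> \<Longrightarrow> \<not> has_nonreal_class m D \<Longrightarrow> D \<in> sols M \<mu>"
  shows "inequivalent_four M \<mu> D1 D2 D3 D4"
proof (rule inequivalent_four_real_classes[OF D _ level])
  have cop: "coprime (1 + t * m) N" for t unfolding N(1) by (rule coprime_1_plus_mult[OF div])
  fix D1 D2 D3 D4 assume "inequivalent_four N \<mu> D1 D2 D3 D4"
  hence sols: "D1 \<in> sols N \<mu>" "D2 \<in> sols N \<mu>" "D3 \<in> sols N \<mu>"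
    and ns: "\<not> sim D1 D2" "\<not> sim D1 D3" "\<not> sim D2 D3"
    by (simp_all add: inequivalent_four_def)
  show "\<not> has_nonreal_class m D1" using no_three_if_all_coprime[OF N cop \<open>\<mu> \<noteq> 0\<close> sols ns] by blast
qed

lemma inequivalent_four_reduce_prime:
  assumes D: "inequivalent_four N \<mu> D1 D2 D3 D4" and N: "N = p * m" "N > 0" and p: "prime p" "p \<ge> 5" "\<not> p dvd m"
    and "\<mu> \<noteq> 0"
    and level_m: "\<And>D1 D2 D3. p < 7 \<Longrightarrow> D1 \<in> sols m \<mu> \<Longrightarrow> D2 \<in> sols m \<mu> \<Longrightarrow> D3 \<in> sols m \<mu> \<Longrightarrow>
      sim D1 D2 \<or> sim D1 D3 \<or> sim D2 D3"
  shows "inequivalent_four m \<mu> D1 D2 D3 D4"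
proof -
  obtain t0 where t0: "t0 < p" and cop: "\<And>t. t < p \<Longrightarrow> t \<noteq> t0 \<Longrightarrow> coprime (1 + t * m) N"
    unfolding N(1) using coprime_1_plus_mult_prime[OF p(1,3)] by blast
  have "odd p" using p(1,2) by (intro prime_odd_nat) auto
  show ?thesis
  proof (rule inequivalent_four_real_classes[OF D _ sols_if_real_classes_odd[OF _ N(1) \<open>odd p\<close>]])
    fix D1 D2 D3 D4 assume D: "inequivalent_four N \<mu> D1 D2 D3 D4"
    show "\<not> has_nonreal_class m D1"
    proof
      assume b: "has_nonreal_class m D1"
      show False
        by (rule no_four_if_nonreal[OF N p(2) cop t0 \<open>\<mu> \<noteq> 0\<close> _ _ _ _ _ _ _ _ _ _ b \<open>odd p\<close> level_m, of D2 D3 D4])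
          (use D in \<open>simp_all add: inequivalent_four_def\<close>)
    qed
  qed
qed

lemma no_inequivalent_four_60:
  assumes "\<mu> \<noteq> 0"
  shows "\<not> inequivalent_four 60 \<mu> D1 D2 D3 D4"
proof
  assume D: "inequivalent_four 60 \<mu> D1 D2 D3 D4"
  have "inequivalent_four 12 \<mu> D1 D2 D3 D4"
  proof (rule inequivalent_four_reduce_prime[OF D, of 5 12])
    show "sim D1 D2 \<or> sim D1 D3 \<or> sim D2 D3"
      if "D1 \<in> sols 12 \<mu>" "D2 \<in> sols 12 \<mu>" "D3 \<in> sols 12 \<mu>" for D1 D2 D3
      using no_three_12[OF that assms] .
  qed (use assms in simp_all)
  hence "{D1, D2, D3} \<subseteq> sols 12 \<mu>" "\<not> sim D1 D2" "\<not> sim D1 D3" "\<not> sim D2 D3"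
    by (simp_all add: inequivalent_four_def)
  thus False using no_three_12[of D1 \<mu> D2 D3] assms by simp
qed

lemma sols_mono: "M dvd N \<Longrightarrow> sols M \<mu> \<subseteq> sols N \<mu>"
  by (auto simp: sols_Pair_iff dvd_def power_mult)

lemma no_inequivalent_four:
  assumes "\<mu> \<noteq> 0"
  shows "N > 0 \<Longrightarrow> \<not> inequivalent_four N \<mu> D1 D2 D3 D4"
proof (induction N rule: less_induct)
  case (less N)
  show ?case
  proof
    assume D: "inequivalent_four N \<mu> D1 D2 D3 D4"
    have square: False if p: "prime p" "odd p" "p\<^sup>2 dvd N" for p
    proof -
      obtain k where "N = p\<^sup>2 * k" using p(3) by blast
      hence k: "N = p * (p * k)" by (simp add: power2_eq_square mult.assoc)
      have "inequivalent_four (p * k) \<mu> D1 D2 D3 D4"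
        by (rule inequivalent_four_reduce[OF D k less.prems prime_gt_1_nat[OF p(1)] assms _ sols_if_real_classes_odd[OF _ k p(2)]])
          (use p(1) primes_dvd_imp_eq in auto)
      moreover have "p * k < N" "p * k > 0"
        using k less.prems prime_gt_1_nat[OF p(1)] by (cases "p * k = 0"; simp)+
      ultimately show False using less.IH by blast
    qed
    have eight: False if dvd8: "8 dvd N"
    proof -
      obtain k where "N = 8 * k" using dvd8 by blast
      \<comment> \<open>Here \<open>q = 4\<close> and \<open>m = N / 4\<close> is even, so the
        descent leads to \<open>2 m = N / 2\<close>.\<close>
      hence k: "N = 4 * (2 * k)" by simp
      have "p dvd 2 * k" if "prime p" "p dvd 4" for p :: nat
        using that prime_dvd_power[of p 2 2] by simp
      hence "inequivalent_four (2 * k * 2) \<mu> D1 D2 D3 D4"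
        by (intro inequivalent_four_reduce[OF D k less.prems _ assms _ sols_if_real_classes]) auto
      moreover have "2 * k * 2 < N" "2 * k * 2 > 0" using k less.prems by auto
      ultimately show False using less.IH by blast
    qed
    have big: False if p: "prime p" "p \<ge> 7" "p dvd N" for p
    proof -
      obtain m where m: "N = p * m" using p(3) by (auto simp: dvd_def)
      have "\<not> p dvd m"
      proof
        assume "p dvd m"
        hence "p\<^sup>2 dvd N" by (simp add: m power2_eq_square)
        thus False using square[OF p(1)] p(1,2) prime_odd_nat[of p] by simp
      qed
      hence "inequivalent_four m \<mu> D1 D2 D3 D4"
        by (intro inequivalent_four_reduce_prime[OF D m less.prems p(1)]) (use p(2) assms in auto)
      moreover have "m < N" "m > 0" using m less.prems prime_gt_1_nat[OF p(1)] by (cases "m = 0"; simp)+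
      ultimately show False using less.IH by blast
    qed
    have "N dvd 60"
    proof (rule multiplicity_le_imp_dvd)
      fix p :: nat assume p: "prime p"
      show "multiplicity p N \<le> multiplicity p 60"
      proof (rule ccontr)
        assume "\<not> ?thesis"
        hence *: "p ^ Suc (multiplicity p 60) dvd N" by (intro multiplicity_dvd') simp
        have le: "p ^ k dvd N" if "p ^ k dvd 60" for k
        proof -
          have "k \<le> multiplicity p 60" using that p by (intro multiplicity_geI) (auto simp: prime_gt_1_nat)
          thus ?thesis using * by (meson dvd_trans le_imp_power_dvd le_SucI)
        qed
        have suc: "p ^ Suc k dvd N" if "p ^ k dvd 60" for k
        proof -
          have "k \<le> multiplicity p 60" using that p by (intro multiplicity_geI) (auto simp: prime_gt_1_nat)
          thus ?thesis using * by (meson dvd_trans le_imp_power_dvd Suc_le_mono)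
        qed
        have "p dvd N" using suc[of 0] by simp
        hence "p < 7" using big p by (meson not_le)
        hence "p \<in> {2, 3, 5}" using p prime_ge_2_nat[OF p] 
          by (cases "p = 4"; cases "p = 6"; auto)
        \<comment> \<open>For \<open>p = 2\<close>, \<open>suc[of 2]\<close> gives
          \<open>8 dvd N\<close>; for 3 and 5, \<open>suc[of 1]\<close> gives that the square of
          \<open>p\<close> divides \<open>N\<close>.\<close>
        thus False
          using suc[of 1] suc[of 2] square[of 3] square[of 5] eight by auto
      qed
    qed (use less.prems in auto)
    hence "inequivalent_four 60 \<mu> D1 D2 D3 D4"
      using D sols_mono[of N 60 \<mu>] by (auto simp: inequivalent_four_def)
    thus False using no_inequivalent_four_60[OF assms] by blast
  qed
qed

text \<open>Roots of unity with equal real parts are equal or conjugate, which leaves two choices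
  per coordinate and two orders.\<close>

lemma card_sim_class_le:
  assumes "D \<in> sols N \<mu>" "N > 0"
  shows "finite {D' \<in> sols N \<mu>. sim D D'}" "card {D' \<in> sols N \<mu>. sim D D'} \<le> 8"
proof -
  obtain x y where e: "D = (x, y)" by (cases D)
  have n: "norm z = 1" if "z ^ N = 1" for z :: complex using norm_eq_1_if_power_eq_1[OF that assms(2)] .
  have conj: "z = w \<or> z = cnj w" if "z ^ N = 1" "w ^ N = 1" "Re w = Re z" for z w :: complex
  proof -
    have "(Im z)\<^sup>2 = (Im w)\<^sup>2" using n[OF that(1)] n[OF that(2)] that(3) cmod_power2[of z] cmod_power2[of w] by simp
    thus ?thesis using that(3) by (auto simp: power2_eq_iff complex_eq_iff)
  qed
  define T where "T = {x, cnj x} \<times> {y, cnj y} \<union> {y, cnj y} \<times> {x, cnj x}"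
  have sub: "{D' \<in> sols N \<mu>. sim D D'} \<subseteq> T"
  proof
    fix D' assume D': "D' \<in> {D' \<in> sols N \<mu>. sim D D'}"
    obtain x' y' where e': "D' = (x', y')" by (cases D')
    show "D' \<in> T"
      using D' assms(1) conj[of x' x] conj[of y' y] conj[of x' y] conj[of y' x]
      by (auto simp: e e' T_def sim_def sols_Pair_iff)
  qed
  have fin: "finite T" by (simp add: T_def)
  thus "finite {D' \<in> sols N \<mu>. sim D D'}" using sub by (rule finite_subset[rotated])
  have two: "card {z, w} \<le> 2" for z w :: complex by (simp add: card_insert_if)
  have "card T \<le> card ({x, cnj x} \<times> {y, cnj y}) + card ({y, cnj y} \<times> {x, cnj x})"
    unfolding T_def by (rule card_Un_le)
  also have "\<dots> \<le> 2 * 2 + 2 * 2"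
    unfolding card_cartesian_product by (intro add_mono mult_mono two) auto
  finally have "card T \<le> 8" by simp
  thus "card {D' \<in> sols N \<mu>. sim D D'} \<le> 8" using card_mono[OF fin sub] by linarith
qed

lemma card_sols_le:
  assumes "N > 0" "\<mu> \<noteq> 0"
  shows "finite (sols N \<mu>)" "card (sols N \<mu>) \<le> 24"
proof -
  define T where "T = (\<lambda>D. {D' \<in> sols N \<mu>. sim D D'})"
  have no4: False if "{D1, D2, D3, D4} \<subseteq> sols N \<mu>" "\<not> sim D1 D2" "\<not> sim D1 D3" "\<not> sim D1 D4" "\<not> sim D2 D3"
    "\<not> sim D2 D4" "\<not> sim D3 D4" for D1 D2 D3 D4
    using no_inequivalent_four[OF assms(2,1), of D1 D2 D3 D4] that by (simp add: inequivalent_four_def)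
  have ex: "\<exists>A B C. {A, B, C} \<subseteq> sols N \<mu> \<and> sols N \<mu> \<subseteq> T A \<union> T B \<union> T C" if ne: "sols N \<mu> \<noteq> {}"
  proof -
    obtain A where A: "A \<in> sols N \<mu>" using ne by blast
    \<comment> \<open>Greedy choice of representatives: \<open>B\<close> is not similar to
      \<open>A\<close> unless \<open>T A\<close> already covers everything, where \<open>A\<close>
      itself is the default. \<open>C\<close> is chosen likewise.\<close>
    obtain B where B: "B \<in> sols N \<mu>" "sim A B \<longrightarrow> sols N \<mu> \<subseteq> T A"
    proof (cases "sols N \<mu> \<subseteq> T A")
      case False
      then obtain B where "B \<in> sols N \<mu>" "\<not> sim A B" by (auto simp: T_def)
      thus ?thesis using that by blast
    next
      case True
      thus ?thesis using that A by blast
    qed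
    obtain C where C: "C \<in> sols N \<mu>" "sim A C \<or> sim B C \<longrightarrow> sols N \<mu> \<subseteq> T A \<union> T B"
    proof (cases "sols N \<mu> \<subseteq> T A \<union> T B")
      case False
      then obtain C where "C \<in> sols N \<mu>" "\<not> sim A C" "\<not> sim B C" by (auto simp: T_def)
      thus ?thesis using that by blast
    next
      case True
      thus ?thesis using that A by blast
    qed
    have "sols N \<mu> \<subseteq> T A \<union> T B \<union> T C"
    proof
      fix D assume D: "D \<in> sols N \<mu>"
      have 1: "sim A B \<longrightarrow> sim A D" using B(2) D unfolding T_def by auto
      have 2: "sim A C \<or> sim B C \<longrightarrow> sim A D \<or> sim B D" using C(2) D unfolding T_def by auto
      have "{A, B, C, D} \<subseteq> sols N \<mu>" using A B(1) C(1) D by simp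
      hence "sim A D \<or> sim B D \<or> sim C D" using no4[of A B C D] 1 2 by argo
      thus "D \<in> T A \<union> T B \<union> T C" using D unfolding T_def by simp
    qed
    thus ?thesis using A B(1) C(1) by blast
  qed
  have "finite (sols N \<mu>) \<and> card (sols N \<mu>) \<le> 24"
  proof (cases "sols N \<mu> = {}")
    case False
    then obtain A B C where ABC: "A \<in> sols N \<mu>" "B \<in> sols N \<mu>" "C \<in> sols N \<mu>"
      and sub: "sols N \<mu> \<subseteq> T A \<union> T B \<union> T C" using ex by blast
    have T: "finite (T D)" "card (T D) \<le> 8" if "D \<in> sols N \<mu>" for D
      using card_sim_class_le[OF that assms(1)] by (simp_all add: T_def)
    have fin: "finite (T A \<union> T B \<union> T C)" using T ABC by simp
    have "card (sols N \<mu>) \<le> card (T A \<union> T B \<union> T C)" by (rule card_mono[OF fin sub])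
    also have "\<dots> \<le> card (T A) + card (T B) + card (T C)"
      by (meson card_Un_le add_le_mono1 le_trans)
    also have "\<dots> \<le> 8 + 8 + 8" using T(2)[OF ABC(1)] T(2)[OF ABC(2)] T(2)[OF ABC(3)] by linarith
    finally show ?thesis using finite_subset[OF sub fin] by simp
  qed simp
  thus "finite (sols N \<mu>)" "card (sols N \<mu>) \<le> 24" by auto
qed

section \<open>Multiplicities and eigenvalues of the torus\<close>

text \<open>Indices map injectively to pairs of \<open>N\<close>-th roots of unity in
  \<open>sols N \<mu>\<close>.\<close>

lemma torus_multiplicity_le:
  assumes "N \<ge> 3" "\<mu> \<noteq> 0"
  shows "torus_multiplicity N \<mu> \<le> 24"
proof -
  have N: "N > 0" using assms(1) by simp
  define g where "g = (\<lambda>k::int. cis (2 * pi * real (nat k) / real N))"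
  define f where "f = (\<lambda>(k1, k2). (g k1, g k2))"
  define K where "K = {k \<in> carrier (torus_group N). torus_eigenvalue N k = \<mu>}"
  have carrier: "carrier (torus_group N) = {0..<int N} \<times> {0..<int N}"
    using N by (auto simp: torus_group_def carrier_integer_mod_group)
  have g_inj: "k = l" if "k \<in> {0..<int N}" "l \<in> {0..<int N}" "g k = g l" for k l
  proof -
    have "nat k = nat l"
      using bij_betw_roots_unity[OF N] that unfolding bij_betw_def inj_on_def by (auto simp: g_def)
    thus ?thesis using that(1,2) eq_nat_nat_iff[of k l] by simp
  qed
  have "inj_on f K"
    using g_inj by (auto simp: inj_on_def f_def K_def carrier)
  moreover have "f ` K \<subseteq> sols N \<mu>"
  proof -
    have gN: "g k ^ N = 1" for k using N by (simp add: g_def DeMoivre)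
    have "Re (g k) = cos (2 * real_of_int k * pi / real N)" if "k \<ge> 0" for k
      using that by (simp add: g_def mult_ac)
    thus ?thesis using gN by (auto simp: K_def f_def sols_Pair_iff carrier torus_eigenvalue_def)
  qed
  ultimately have "card K \<le> card (sols N \<mu>)"
    using card_inj_on_le card_sols_le(1)[OF N assms(2)] by blast
  thus ?thesis
    using card_sols_le(2)[OF N assms(2)] by (simp add: torus_multiplicity_def K_def)
qed

lemma cos_2pi_cong:
  assumes "[m = m'] (mod int N)" "N > 0"
  shows "cos (2 * pi * real_of_int m / real N) = cos (2 * pi * real_of_int m' / real N)"
proof -
  obtain q where q: "m = m' + int N * q" using assms(1) by (metis cong_iff_lin cong_sym mult.commute)
  have "2 * pi * real_of_int m / real N = 2 * pi * real_of_int m' / real N + 2 * pi * real_of_int q"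
    using assms(2) by (simp add: q field_simps)
  thus ?thesis by (simp add: cos_add cos_int_2pin sin_int_2pin)
qed

text \<open>The real part \<chi> of a character is an eigenvector: the addition theorem pairs
  opposite neighbours, and \<chi> is 1 at the origin, so the vector is not 0.\<close>

lemma eigenvalue_torus_adjacency_mat:
  assumes N: "N \<ge> 3"
  shows "eigenvalue (torus_adjacency_mat N) (torus_eigenvalue N (k1, k2))"
proof -
  let ?G = "torus_group N"
  define S :: "(int \<times> int) set" where "S = {(0, 1), (0, (- 1) mod int N), (1, 0), ((- 1) mod int N, 0)}"
  define vs where "vs = torus_vertices N"
  define n where "n = length vs"
  define A where "A = torus_adjacency_mat N"
  define \<chi> where "\<chi> = (\<lambda>(a, b). cos (2 * pi * real_of_int (k1 * a + k2 * b) / real N))"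
  define v where "v = vec n (\<lambda>i. \<chi> (vs ! i))"
  define \<mu> where "\<mu> = torus_eigenvalue N (k1, k2)"
  have N0: "N > 0" using N by simp
  have grp: "group ?G" unfolding torus_group_def by (intro DirProd_group group_integer_mod_group)
  have carrier: "carrier ?G = {0..<int N} \<times> {0..<int N}"
    using N0 by (auto simp: torus_group_def carrier_integer_mod_group)
  have m1: "(- 1) mod int N = int N - 1" using N by (simp add: zmod_minus1)
  have S: "S \<subseteq> carrier ?G" using N by (auto simp: S_def carrier m1)
  have vs: "distinct vs" "set vs = carrier ?G"
    using distinct_torus_vertices set_torus_vertices[OF N0]
    by (simp_all add: vs_def discrete_torus_def cayley_graph_def)
  have arc: "(x, w) \<in> parcs (discrete_torus N) \<longleftrightarrow> w \<in> (\<lambda>s. x \<otimes>\<^bsub>?G\<^esub> s) ` S" if "x \<in> carrier ?G" for x w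
  proof -
    have "parcs (discrete_torus N) = {(x, x \<otimes>\<^bsub>?G\<^esub> s) | x s. x \<in> carrier ?G \<and> s \<in> S}"
      by (simp add: discrete_torus_def cayley_graph_def S_def)
    thus ?thesis using that by blast
  qed
  have inj: "inj_on (\<lambda>s. x \<otimes>\<^bsub>?G\<^esub> s) S" if "x \<in> carrier ?G" for x
    using inj_on_subset[OF group.inj_on_cmult[OF grp that] S] .
  have \<chi>_mult: "\<chi> ((a, b) \<otimes>\<^bsub>?G\<^esub> (s, t)) = cos (2 * pi * real_of_int (k1 * (a + s) + k2 * (b + t)) / real N)"
    for a b s t
  proof -
    have "[k1 * ((a + s) mod int N) + k2 * ((b + t) mod int N) = k1 * (a + s) + k2 * (b + t)] (mod int N)"
      by (intro cong_add cong_mult cong_refl) (simp_all add: cong_def)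
    from cos_2pi_cong[OF this N0] show ?thesis
      by (simp add: \<chi>_def torus_group_def integer_mod_group_def)
  qed
  have key: "(\<Sum>s\<in>S. \<chi> (x \<otimes>\<^bsub>?G\<^esub> s)) = \<mu> * \<chi> x" for x
  proof -
    obtain a b where x: "x = (a, b)" by (cases x)
    define \<theta> where "\<theta> = 2 * pi * real_of_int (k1 * a + k2 * b) / real N"
    define \<alpha> where "\<alpha> = 2 * pi * real_of_int k1 / real N"
    define \<beta> where "\<beta> = 2 * pi * real_of_int k2 / real N"
    have "\<chi> (x \<otimes>\<^bsub>?G\<^esub> (0, 1)) = cos (\<theta> + \<beta>)" "\<chi> (x \<otimes>\<^bsub>?G\<^esub> (1, 0)) = cos (\<theta> + \<alpha>)"
      unfolding x \<chi>_mult \<theta>_def \<alpha>_def \<beta>_def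
      by (simp_all add: algebra_simps add_divide_distrib)
    moreover have "\<chi> (x \<otimes>\<^bsub>?G\<^esub> (0, (- 1) mod int N)) = cos (\<theta> - \<beta>)"
    proof -
      have "[k1 * (a + 0) + k2 * (b + (- 1) mod int N) = k1 * a + k2 * (b + (- 1))] (mod int N)"
        by (intro cong_add cong_mult cong_refl) (simp_all add: cong_def)
      from cos_2pi_cong[OF this N0] show ?thesis
        unfolding x \<chi>_mult \<theta>_def \<beta>_def by (simp add: algebra_simps add_divide_distrib diff_divide_distrib)
    qed
    moreover have "\<chi> (x \<otimes>\<^bsub>?G\<^esub> ((- 1) mod int N, 0)) = cos (\<theta> - \<alpha>)"
    proof -
      have "[k1 * (a + (- 1) mod int N) + k2 * (b + 0) = k1 * (a + (- 1)) + k2 * b] (mod int N)"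
        by (intro cong_add cong_mult cong_refl) (simp_all add: cong_def)
      from cos_2pi_cong[OF this N0] show ?thesis
        unfolding x \<chi>_mult \<theta>_def \<alpha>_def by (simp add: algebra_simps add_divide_distrib diff_divide_distrib)
    qed
    \<comment> \<open>The four generators are distinct because \<open>N \<ge> 3\<close>.\<close>
    moreover have "(\<Sum>s\<in>S. f s) = f (0, 1) + f (0, (- 1) mod int N) + f (1, 0) + f ((- 1) mod int N, 0)"
      for f :: "int \<times> int \<Rightarrow> real"
      using N by (simp add: S_def m1 add_ac)
    ultimately have "(\<Sum>s\<in>S. \<chi> (x \<otimes>\<^bsub>?G\<^esub> s)) = cos (\<theta> + \<beta>) + cos (\<theta> - \<beta>) + cos (\<theta> + \<alpha>) + cos (\<theta> - \<alpha>)"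
      by simp
    also have "\<dots> = (2 * cos \<alpha> + 2 * cos \<beta>) * cos \<theta>"
      by (simp add: cos_add cos_diff algebra_simps)
    also have "2 * cos \<alpha> + 2 * cos \<beta> = \<mu>"
      by (simp add: \<mu>_def torus_eigenvalue_def \<alpha>_def \<beta>_def mult_ac)
    also have "cos \<theta> = \<chi> x" by (simp add: \<chi>_def \<theta>_def x)
    finally show ?thesis .
  qed
  have A: "A \<in> carrier_mat n n" by (simp add: A_def torus_adjacency_mat_def adjacency_mat_def n_def vs_def)
  have "A *\<^sub>v v = \<mu> \<cdot>\<^sub>v v"
  proof (rule eq_vecI)
    fix i assume "i < dim_vec (\<mu> \<cdot>\<^sub>v v)"
    hence i: "i < n" by (simp add: v_def)
    hence x: "vs ! i \<in> carrier ?G" using vs(2) by (metis n_def nth_mem)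
    have "(A *\<^sub>v v) $ i = (\<Sum>j<n. A $$ (i, j) * v $ j)"
      using A i by (auto simp: v_def scalar_prod_def atLeast0LessThan)
    also have "\<dots> = (\<Sum>j<n. if (vs ! i, vs ! j) \<in> parcs (discrete_torus N) then \<chi> (vs ! j) else 0)"
      using i by (intro sum.cong) (auto simp: A_def torus_adjacency_mat_def adjacency_mat_def n_def vs_def v_def)
    also have "\<dots> = (\<Sum>w\<in>carrier ?G. if (vs ! i, w) \<in> parcs (discrete_torus N) then \<chi> w else 0)"
      by (rule sum.reindex_bij_betw[OF bij_betw_nth]) (use vs in \<open>simp_all add: n_def\<close>)
    also have "\<dots> = (\<Sum>w\<in>(\<lambda>s. vs ! i \<otimes>\<^bsub>?G\<^esub> s) ` S. \<chi> w)"
    proof (rule sum.mono_neutral_cong_right)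
      show "finite (carrier ?G)" by (simp add: carrier)
      show "(\<lambda>s. vs ! i \<otimes>\<^bsub>?G\<^esub> s) ` S \<subseteq> carrier ?G"
        using S monoid.m_closed[OF group.is_monoid[OF grp] x] by auto
    qed (use arc[OF x] in auto)
    also have "\<dots> = (\<Sum>s\<in>S. \<chi> (vs ! i \<otimes>\<^bsub>?G\<^esub> s))"
      by (simp add: sum.reindex[OF inj[OF x]])
    also have "\<dots> = (\<mu> \<cdot>\<^sub>v v) $ i" using i by (simp add: key v_def)
    finally show "(A *\<^sub>v v) $ i = (\<mu> \<cdot>\<^sub>v v) $ i" .
  qed (use A in \<open>simp add: v_def\<close>)
  moreover have "v \<noteq> 0\<^sub>v n"
  proof
    assume v0: "v = 0\<^sub>v n"
    have "(0, 0) \<in> set vs" using N by (simp add: vs(2) carrier)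
    then obtain i where i: "i < n" "vs ! i = (0, 0)" by (metis in_set_conv_nth n_def)
    have "v $ i = 1" using i by (simp add: v_def \<chi>_def)
    thus False using i v0 by simp
  qed
  moreover have "v \<in> carrier_vec n" by (simp add: v_def)
  ultimately have "eigenvector A v \<mu>" using A by (simp add: eigenvector_def)
  thus ?thesis unfolding eigenvalue_def A_def \<mu>_def by blast
qed

section \<open>Sharpness for \<open>N = 60\<close>\<close>

lemma cos_pi_fifth_pos: "cos (pi / 5) > 0"
  by (rule cos_gt_zero) simp_all

text \<open>For the angle \<pi>/5 the triple and the double angle add up to \<pi>. This gives a
  cubic for \<open>a = cos (pi / 5)\<close>, and after removing the factor \<open>a + 1\<close> a
  quadratic that is the claim.\<close>

lemma cos_pi_fifth_eq: "cos (pi / 5) = 1 / 2 + cos (2 * pi / 5)"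
proof -
  define a where "a = cos (pi / 5)"
  have a: "a > 0" unfolding a_def by (rule cos_pi_fifth_pos)
  have b: "cos (2 * pi / 5) = 2 * a\<^sup>2 - 1" using cos_double_cos[of "pi / 5"] by (simp add: a_def)
  have "3 * (pi / 5) = pi - 2 * pi / 5" by simp
  hence "cos (3 * (pi / 5)) = cos (pi - 2 * pi / 5)" by (rule arg_cong)
  also have "\<dots> = - cos (2 * pi / 5)" by (rule cos_pi_minus)
  finally have "4 * a ^ 3 - 3 * a = - (2 * a\<^sup>2 - 1)" using cos_treble_cos[of "pi / 5"] b by (simp add: a_def)
  hence "(a + 1) * (4 * a\<^sup>2 - 2 * a - 1) = 0" by (simp add: power2_eq_square power3_eq_cube algebra_simps)
  hence "4 * a\<^sup>2 - 2 * a - 1 = 0" using a by simp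
  thus ?thesis unfolding b by (simp add: a_def[symmetric])
qed

lemma torus_multiplicity_60:
  "torus_multiplicity 60 (2 * cos (pi / 5)) = 24"
proof -
  define \<mu> where "\<mu> = 2 * cos (pi / 5)"
  define c where "c = (\<lambda>k::int. cos (2 * real_of_int k * pi / 60))"
  have ev: "torus_eigenvalue 60 (k, l) = 2 * c k + 2 * c l" for k l
    by (simp add: torus_eigenvalue_def c_def)
  have refl: "c (60 - k) = c k" for k
  proof -
    have "2 * real_of_int (60 - k) * pi / 60 = 2 * pi - 2 * real_of_int k * pi / 60" by (simp add: field_simps)
    thus ?thesis unfolding c_def by (simp only: cos_diff) simp
  qed
  have c1: "c 6 = cos (pi / 5)" "c 15 = 0" "c 10 = 1 / 2" "c 12 = cos (2 * pi / 5)"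
    by (simp_all add: c_def cos_60)
  have c2: "c 4 + c 16 = cos (pi / 5)"
  proof -
    \<comment> \<open>Sum-to-product: the mean of the two angles is \<pi>/3, half their difference
      is \<pi>/5.\<close>
    have "c 16 + c 4 = 2 * cos (pi / 3) * cos (pi / 5)"
      unfolding c_def cos_plus_cos by (simp add: cos_60 mult_ac flip: add_divide_distrib diff_divide_distrib) 
    thus ?thesis by (simp add: cos_60)
  qed
  have c': "c 54 = c 6" "c 45 = c 15" "c 50 = c 10" "c 48 = c 12" "c 56 = c 4" "c 44 = c 16"
    using refl[of 6] refl[of 15] refl[of 10] refl[of 12] refl[of 4] refl[of 16] by simp_all
  \<comment> \<open>The three representations of \<open>cos (pi / 5)\<close> as a sum of two
    cosines, in units of 2\<pi>/60; each yields eight indices by reflection \<open>k\<close> to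
    \<open>60 - k\<close> and exchange.\<close>
  define P :: "(int \<times> int) list" where "P = [(6, 15), (10, 12), (4, 16)]"
  define L where "L = concat (map (\<lambda>(k, l). [(k, l), (60 - k, l), (k, 60 - l), (60 - k, 60 - l),
     (l, k), (l, 60 - k), (60 - l, k), (60 - l, 60 - k)]) P)"
  have "distinct L" by (simp add: L_def P_def)
  moreover have "length L = 24" by (simp add: L_def P_def)
  ultimately have "card (set L) = 24" by (simp add: distinct_card)
  moreover have "set L \<subseteq> {k \<in> carrier (torus_group 60). torus_eigenvalue 60 k = \<mu>}"
    using c1 c2 cos_pi_fifth_eq
    by (simp add: L_def P_def ev c' \<mu>_def torus_group_def carrier_integer_mod_group)
  moreover have "finite {k \<in> carrier (torus_group 60). torus_eigenvalue 60 k = \<mu>}"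
    by (simp add: torus_group_def carrier_integer_mod_group)
  ultimately have "24 \<le> torus_multiplicity 60 \<mu>"
    unfolding torus_multiplicity_def by (metis card_mono)
  moreover have "\<mu> \<noteq> 0"
    using cos_pi_fifth_pos by (simp add: \<mu>_def)
  ultimately show ?thesis
    using torus_multiplicity_le[of 60 \<mu>] by (simp add: \<mu>_def)
qed

theorem theorem1:
  shows "(\<forall>N::nat. N \<ge> 3 \<longrightarrow> (\<forall>\<mu>::real. eigenvalue (torus_adjacency_mat N) \<mu> \<and> \<mu> \<noteq> 0
            \<longrightarrow> torus_multiplicity N \<mu> \<le> 24))
       \<and> (\<exists>N::nat. N \<ge> 3 \<and> (\<exists>\<mu>::real. eigenvalue (torus_adjacency_mat N) \<mu> \<and> \<mu> \<noteq> 0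
            \<and> torus_multiplicity N \<mu> = 24))"
proof (intro conjI)
  show "\<exists>N::nat. N \<ge> 3 \<and> (\<exists>\<mu>::real. eigenvalue (torus_adjacency_mat N) \<mu> \<and> \<mu> \<noteq> 0
      \<and> torus_multiplicity N \<mu> = 24)"
  proof (intro exI conjI)
    have "torus_eigenvalue 60 (6, 15) = 2 * cos (pi / 5)"
      by (simp add: torus_eigenvalue_def)
    thus "eigenvalue (torus_adjacency_mat 60) (2 * cos (pi / 5))"
      using eigenvalue_torus_adjacency_mat[of 60 6 15] by simp
    show "2 * cos (pi / 5) \<noteq> 0" using cos_pi_fifth_pos by simp
  qed (simp_all add: torus_multiplicity_60)
qed (use torus_multiplicity_le in blast)

end
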